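(* Let $A$ be a $2\times2$ integer matrix with $|\det A|=1$ and no eigenvalues on the unit circle, and define $T\colon\mathbb{T}^2\to\mathbb{T}^2$ by $Tx=Ax\bmod 1$. Let $m$ be the Lebesgue measure on $\mathbb{T}^2$. Let $(M_k)_{k\ge1}$ be a monotonically decreasing sequence in $[0,1]$ such that $M_k\le C(\log k)^{-2}$ for all $k\ge2$, for some constant $C>0$; let $r_k\ge0$ be such that the open ball $B(x,r_k)$ around $x$ has measure $m(B(x,r_k))=M_k=\pi r_k^2$, and let $\Phi(n)=\sum_{k=1}^nM_k=\pi\sum_{k=1}^{n}r_k^2$. Then for all $\varepsilon>0$, \[ \sum_{k=1}^{n}\mathbf{1}_{B(x,r_k)}(T^kx)=\Phi(n)+O\bigl(\Phi(n)^{1/2}(\log\Phi(n))^{3/2+\varepsilon}\bigr)\qquad(n\to\infty) \] for $m$-a.e. $x$.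
   Context: $\mathbb{T}^2=\mathbb{R}^2/\mathbb{Z}^2$ with its usual flat metric; $B(x,r)$ is the open ball of radius $r$ around $x$; $\mathbf{1}_E$ is the indicator function of $E$. The implied constant in $O(\cdot)$ may depend on $x$ and $\varepsilon$. Convention: if $\Phi(n)$ stays bounded, the conclusion is read as saying that the difference of the two sums is bounded in $n$ for $m$-a.e. $x$. *)

theory Defs
  imports "HOL-Analysis.Analysis" "HOL-Library.Landau_Symbols"
begin

definition int_lattice :: "(real^2) set" where
  "int_lattice = {x. \<forall>i. x $ i \<in> \<int>}"

lemma int_lattice_0 [simp]: "0 \<in> int_lattice"
  by (simp add: int_lattice_def)

lemma int_lattice_add: "a \<in> int_lattice \<Longrightarrow> b \<in> int_lattice \<Longrightarrow> a + b \<in> int_lattice"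
  by (simp add: int_lattice_def)

lemma int_lattice_uminus: "a \<in> int_lattice \<Longrightarrow> - a \<in> int_lattice"
  by (simp add: int_lattice_def)

lemma int_lattice_diff: "a \<in> int_lattice \<Longrightarrow> b \<in> int_lattice \<Longrightarrow> a - b \<in> int_lattice"
  by (simp add: int_lattice_def)

lemma int_lattice_matrix:
  fixes A :: "int^2^2"
  assumes "a \<in> int_lattice"
  shows "map_matrix of_int A *v a \<in> int_lattice"
  using assms by (simp add: int_lattice_def matrix_vector_mult_def sum_2)

lemma closed_int_lattice: "closed int_lattice"
proof -
  have "int_lattice = (\<Inter>i. (\<lambda>x::real^2. x $ i) -` \<int>)"
    by (auto simp: int_lattice_def)
  moreover have "closed ((\<lambda>x::real^2. x $ i) -` \<int>)" for i
    by (intro closed_vimage closed_Ints continuous_intros)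
  ultimately show ?thesis
    by (metis closed_INT)
qed

quotient_type torus2 = "real^2" / "\<lambda>x y. x - y \<in> int_lattice"
proof (rule equivpI)
  show "reflp (\<lambda>x y. x - y \<in> int_lattice)"
    by (simp add: reflp_def)
  show "symp (\<lambda>x y. x - y \<in> int_lattice)"
    unfolding symp_def using int_lattice_uminus by fastforce
  show "transp (\<lambda>x y. x - y \<in> int_lattice)"
    unfolding transp_def using int_lattice_add by fastforce
qed

lemma infdist_int_lattice_shift:
  assumes "u - v \<in> int_lattice"
  shows "infdist u int_lattice \<le> infdist v int_lattice"
proof -
  obtain a where a: "a \<in> int_lattice" "infdist v int_lattice = dist v a"
    using infdist_attains_inf[OF closed_int_lattice, of v] int_lattice_0 by blast
  have "infdist u int_lattice \<le> dist u (a + (u - v))"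
    by (intro infdist_le int_lattice_add a assms)
  also have "\<dots> = dist v a"
    by (simp add: dist_norm algebra_simps)
  finally show ?thesis using a by simp
qed

text \<open>The flat metric: the distance of \<open>x\<close> and \<open>y\<close> modulo the lattice is
  the minimum of \<open>norm (x - y - a)\<close> over lattice points \<open>a\<close>.\<close>

instantiation torus2 :: metric_space
begin

lift_definition dist_torus2 :: "torus2 \<Rightarrow> torus2 \<Rightarrow> real" is
  "\<lambda>x y. infdist (x - y) int_lattice"
proof (rule antisym)
  fix x x' y y' :: "real^2"
  assume *: "x - x' \<in> int_lattice" "y - y' \<in> int_lattice"
  have "(x - y) - (x' - y') = (x - x') - (y - y')" "(x' - y') - (x - y) = (y - y') - (x - x')"
    by simp_all
  then have "(x - y) - (x' - y') \<in> int_lattice" "(x' - y') - (x - y) \<in> int_lattice"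
    using * by (metis int_lattice_diff)+
  then show "infdist (x - y) int_lattice \<le> infdist (x' - y') int_lattice"
    "infdist (x' - y') int_lattice \<le> infdist (x - y) int_lattice"
    by (auto intro: infdist_int_lattice_shift)
qed

definition uniformity_torus2 :: "(torus2 \<times> torus2) filter" where
  "uniformity_torus2 = (INF e\<in>{0<..}. principal {(x, y). dist x y < e})"

definition open_torus2 :: "torus2 set \<Rightarrow> bool" where
  "open_torus2 U \<longleftrightarrow> (\<forall>x\<in>U. \<forall>\<^sub>F (x', y) in uniformity. x' = x \<longrightarrow> y \<in> U)"

instance
proof
  show "dist x y = 0 \<longleftrightarrow> x = y" for x y :: torus2
  proof transfer
    fix x y :: "real^2"
    show "infdist (x - y) int_lattice = 0 \<longleftrightarrow> x - y \<in> int_lattice"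
      using in_closed_iff_infdist_zero[OF closed_int_lattice, of "x - y"] int_lattice_0 by blast
  qed
  show "dist x y \<le> dist x z + dist y z" for x y z :: torus2
  proof transfer
    fix x y z :: "real^2"
    obtain a where a: "a \<in> int_lattice" "infdist (x - z) int_lattice = dist (x - z) a"
      using infdist_attains_inf[OF closed_int_lattice, of "x - z"] int_lattice_0 by blast
    obtain b where b: "b \<in> int_lattice" "infdist (y - z) int_lattice = dist (y - z) b"
      using infdist_attains_inf[OF closed_int_lattice, of "y - z"] int_lattice_0 by blast
    have "infdist (x - y) int_lattice \<le> dist (x - y) (a - b)"
      by (intro infdist_le int_lattice_diff a b)
    also have "\<dots> = norm ((x - z - a) - (y - z - b))"
      by (simp add: dist_norm algebra_simps)
    also have "\<dots> \<le> norm (x - z - a) + norm (y - z - b)"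
      by (rule norm_triangle_ineq4)
    finally show "infdist (x - y) int_lattice
        \<le> infdist (x - z) int_lattice + infdist (y - z) int_lattice"
      using a b by (simp add: dist_norm)
  qed
qed (simp_all add: uniformity_torus2_def open_torus2_def)

end

lemma dist_abs_torus2_le: "dist (abs_torus2 x) (abs_torus2 y) \<le> dist x y"
proof -
  have "infdist (x - y) int_lattice \<le> dist (x - y) 0"
    by (intro infdist_le) simp
  then show ?thesis
    by (simp add: dist_torus2.abs_eq dist_norm)
qed

lemma continuous_on_abs_torus2: "continuous_on S abs_torus2"
  unfolding continuous_on_iff using dist_abs_torus2_le by (meson le_less_trans)

definition unit_square :: "(real^2) set" where
  "unit_square = {x. \<forall>i. 0 \<le> x $ i \<and> x $ i < 1}"

text \<open>Lebesgue measure on the torus, as a Borel measure: the image of planar Lebesgue measure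
  on the fundamental domain \<open>[0,1)\<^sup>2\<close> under the projection.\<close>

definition torus_lborel :: "torus2 measure" where
  "torus_lborel = distr (restrict_space lborel unit_square) borel abs_torus2"

lemma measurable_abs_torus2: "abs_torus2 \<in> restrict_space lborel unit_square \<rightarrow>\<^sub>M borel"
  by (intro measurable_restrict_space1)
    (simp add: borel_measurable_continuous_onI continuous_on_abs_torus2)

lift_definition torus_map :: "int^2^2 \<Rightarrow> torus2 \<Rightarrow> torus2" is
  "\<lambda>A x. map_matrix of_int A *v x"
  by (metis int_lattice_matrix matrix_vector_mult_diff_distrib)

definition matrix_eigenvalue :: "'a::field^'n^'n \<Rightarrow> 'a \<Rightarrow> bool" where
  "matrix_eigenvalue A c \<longleftrightarrow> (\<exists>v. v \<noteq> 0 \<and> A *v v = c *s v)"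

end

theory Submission
  imports Defs "HOL-Probability.Probability_Measure"
begin

text \<open>
  Write \<open>E\<^sub>k\<close> for the set of points \<open>x\<close> with \<open>d(x, T\<^sup>k x) < r\<^sub>k\<close>. Membership of \<open>x\<close> in \<open>E\<^sub>k\<close> only
  depends on \<open>D\<^sub>k x\<close>, where \<open>D\<^sub>k = I - A\<^sup>k\<close>: it says that \<open>D\<^sub>k x\<close> is within \<open>r\<^sub>k\<close> of the lattice.
  Since \<open>A\<close> has no eigenvalue of modulus one, \<open>D\<^sub>k\<close> is invertible over the reals, hence a
  surjective endomorphism of the torus, hence measure preserving. So \<open>E\<^sub>k\<close> has measure exactly
  \<open>M\<^sub>k\<close>, although it is defined by a ball whose centre moves with \<open>x\<close>.

  The essential point is that the \<open>E\<^sub>k\<close> are nearly independent. For \<open>j < k\<close> put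
  \<open>q = (k - j) div 2\<close> and translate \<open>x\<close> by \<open>H w = D\<^sub>k\<^sup>-\<^sup>1 A\<^sup>q w\<close> with \<open>w\<close> in the unit square. This moves
  \<open>D\<^sub>k x\<close> by \<open>A\<^sup>q w\<close>, which is exactly equidistributed on the torus as \<open>w\<close> varies, and it moves
  \<open>D\<^sub>j x\<close> by \<open>D\<^sub>j D\<^sub>k\<^sup>-\<^sup>1 A\<^sup>q w\<close>. On the expanding eigenline that operator has size about
  \<open>\<bar>\<alpha>\<bar>\<^bsup>j - k + q\<^esup>\<close>, on the contracting one about \<open>\<bar>\<alpha>\<bar>\<^bsup>-q\<^esup>\<close>, so it is of order \<open>\<theta>\<^bsup>k - j\<^esup>\<close> with
  \<open>\<theta> = \<bar>\<alpha>\<bar>\<^bsup>-1/2\<^esup> < 1\<close>. Averaging over \<open>w\<close> therefore bounds the measure of \<open>E\<^sub>j \<inter> E\<^sub>k\<close> by \<open>M\<^sub>k\<close>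
  times the measure of a ball of radius \<open>r\<^sub>j + O(\<theta>\<^bsup>k - j\<^esup>)\<close>, that is, by
  \<open>M\<^sub>j M\<^sub>k + O(\<theta>\<^bsup>k - j\<^esup> M\<^sub>k)\<close> (lemmas \<open>nn_integral_decorrelate\<close>, \<open>steering_vectors\<close> and
  \<open>return_sets_quasi_independent\<close>). Because the error is summable over \<open>j\<close>, the variance of the
  number of returns with time in an interval is at most a constant times the sum of the \<open>M\<^sub>k\<close>
  over that interval (\<open>quasi_independent_variance\<close>).

  A variance bound of this kind gives the almost sure estimate by the method of Gal and Koksma
  (\<open>gal_koksma\<close>): sample time where \<open>\<Phi>\<close> passes the integers, control all sampled fluctuations
  up to level \<open>2\<^sup>s\<close> by the dyadic chaining of Rademacher and Menshov, and interpolate by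
  monotonicity. If \<open>\<Phi>\<close> is bounded, the Borel-Cantelli lemma leaves only finitely many returns.
\<close>

section \<open>Integration of periodic functions over the unit square\<close>

abbreviation square :: "(real^2) measure" where
  "square \<equiv> restrict_space lborel unit_square"

definition periodic :: "(real^2 \<Rightarrow> 'b) \<Rightarrow> bool" where
  "periodic f \<longleftrightarrow> (\<forall>x. \<forall>z\<in>int_lattice. f (x + z) = f x)"

lemma unit_square_eq: "unit_square = {x. (0 \<le> x$1 \<and> x$1 < 1) \<and> (0 \<le> x$2 \<and> x$2 < 1)}"
  by (auto simp: unit_square_def forall_2)

lemma sets_unit_square [measurable]: "unit_square \<in> sets borel"
proof -
  have [measurable]: "(\<lambda>x::real^2. x $ i) \<in> borel_measurable borel" for i
    by (intro borel_measurable_continuous_onI continuous_intros)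
  show ?thesis
    unfolding unit_square_eq by measurable
qed

lemma nn_integral_square:
  "f \<in> borel_measurable borel \<Longrightarrow> (\<integral>\<^sup>+x. f x \<partial>square) = (\<integral>\<^sup>+x. f x * indicator unit_square x \<partial>lborel)"
  by (subst nn_integral_restrict_space) auto

definition lattice_point :: "int \<times> int \<Rightarrow> real^2" where
  "lattice_point p = vector [of_int (fst p), of_int (snd p)]"

text \<open>A listing of the lattice by natural numbers, so that lattice sums become series.\<close>
definition enum_lattice :: "nat \<Rightarrow> real^2" where
  "enum_lattice n = from_nat_into int_lattice n"

lemma bij_enum_lattice: "bij_betw enum_lattice UNIV int_lattice"
proof -
  have eq: "int_lattice = range lattice_point"
  proof (intro equalityI subsetI)
    fix x assume "x \<in> int_lattice"
    then have "x = lattice_point (\<lfloor>x$1\<rfloor>, \<lfloor>x$2\<rfloor>)"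
      by (simp add: int_lattice_def lattice_point_def vec_eq_iff forall_2)
    then show "x \<in> range lattice_point" by blast
  qed (auto simp: int_lattice_def lattice_point_def forall_2)
  have "inj lattice_point"
    by (auto simp: inj_on_def lattice_point_def vec_eq_iff forall_2)
  then have "infinite int_lattice"
    unfolding eq by (simp add: finite_image_iff finite_prod)
  moreover have "countable int_lattice" unfolding eq by simp
  moreover have "enum_lattice = from_nat_into int_lattice"
    by (rule ext) (rule enum_lattice_def)
  ultimately show ?thesis
    using bij_betw_from_nat_into[of int_lattice] by simp
qed

lemma enum_lattice_in: "enum_lattice n \<in> int_lattice"
  using bij_enum_lattice by (auto simp: bij_betw_def)

lemma unit_square_tiles: "\<exists>!z. z \<in> int_lattice \<and> x + z \<in> unit_square"
proof (rule ex1I[of _ "\<chi> i. - of_int \<lfloor>x $ i\<rfloor>"])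
  show "(\<chi> i. - of_int \<lfloor>x $ i\<rfloor>) \<in> int_lattice \<and> x + (\<chi> i. - of_int \<lfloor>x $ i\<rfloor>) \<in> unit_square"
    by (auto simp: int_lattice_def unit_square_def) linarith
  fix z assume z: "z \<in> int_lattice \<and> x + z \<in> unit_square"
  have "z $ i = - of_int \<lfloor>x $ i\<rfloor>" for i
  proof -
    from z obtain m where m: "z $ i = of_int m"
      by (auto simp: int_lattice_def elim: Ints_cases)
    moreover have "0 \<le> x $ i + z $ i" "x $ i + z $ i < 1"
      using z by (auto simp: unit_square_def)
    ultimately have "\<lfloor>x $ i\<rfloor> = - m" by (intro floor_unique) auto
    with m show ?thesis by simp
  qed
  then show "z = (\<chi> i. - of_int \<lfloor>x $ i\<rfloor>)" by (simp add: vec_eq_iff)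
qed

lemma suminf_indicator_unique:
  fixes g :: "nat \<Rightarrow> 'b"
  assumes "\<exists>!n. g n \<in> S"
  shows "(\<Sum>n. indicator S (g n) :: ennreal) = 1"
proof -
  obtain m where m: "g m \<in> S" "\<And>n. g n \<in> S \<Longrightarrow> n = m"
    using assms by blast
  have *: "g n \<in> S \<longleftrightarrow> n = m" for n using m by blast
  have eq: "(\<lambda>n. indicator S (g n) :: ennreal) = (\<lambda>n. if n = m then 1 else 0)"
    by (simp only: indicator_def * of_bool_def)
  show ?thesis
    unfolding eq by (rule sums_unique[symmetric]) (rule sums_single)
qed

lemma enum_lattice_surj: "z \<in> int_lattice \<Longrightarrow> \<exists>n. enum_lattice n = z"
  using bij_betw_imp_surj_on[OF bij_enum_lattice] by (metis rangeE)

lemma enum_lattice_inj: "enum_lattice a = enum_lattice b \<Longrightarrow> a = b"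
  using bij_betw_imp_inj_on[OF bij_enum_lattice] by (simp add: inj_eq)

lemma suminf_indicator_square:
  "(\<Sum>n. indicator unit_square (x + enum_lattice n) :: ennreal) = 1"
  "(\<Sum>n. indicator unit_square (x - enum_lattice n) :: ennreal) = 1"
proof -
  obtain z where z: "z \<in> int_lattice" "x + z \<in> unit_square"
    and u: "\<And>y. y \<in> int_lattice \<Longrightarrow> x + y \<in> unit_square \<Longrightarrow> y = z"
    using unit_square_tiles[of x] by (auto elim!: ex1E)
  obtain a b where a: "enum_lattice a = z" and b: "enum_lattice b = - z"
    using enum_lattice_surj[OF z(1)] enum_lattice_surj[OF int_lattice_uminus[OF z(1)]] by auto
  have "\<exists>!n. x + enum_lattice n \<in> unit_square"
  proof (rule ex1I)
    show "x + enum_lattice a \<in> unit_square" using a z by simp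
    fix n assume "x + enum_lattice n \<in> unit_square"
    then have "enum_lattice n = z" by (rule u[OF enum_lattice_in])
    then show "n = a" by (intro enum_lattice_inj) (simp add: a)
  qed
  then show "(\<Sum>n. indicator unit_square (x + enum_lattice n) :: ennreal) = 1"
    by (rule suminf_indicator_unique)
  have "\<exists>!n. x - enum_lattice n \<in> unit_square"
  proof (rule ex1I)
    show "x - enum_lattice b \<in> unit_square" using b z by simp
    fix n assume "x - enum_lattice n \<in> unit_square"
    then have "x + - enum_lattice n \<in> unit_square" by simp
    then have "- enum_lattice n = z" by (rule u[OF int_lattice_uminus[OF enum_lattice_in]])
    then have "enum_lattice n = - z" by auto
    then show "n = b" by (intro enum_lattice_inj) (simp add: b)
  qed
  then show "(\<Sum>n. indicator unit_square (x - enum_lattice n) :: ennreal) = 1"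
    by (rule suminf_indicator_unique)
qed

lemma nn_integral_lborel_shift:
  fixes g :: "real^2 \<Rightarrow> ennreal"
  assumes "g \<in> borel_measurable borel"
  shows "(\<integral>\<^sup>+x. g (x + t) \<partial>lborel) = (\<integral>\<^sup>+x. g x \<partial>lborel)"
proof -
  have "(\<integral>\<^sup>+x. g x \<partial>lborel) = (\<integral>\<^sup>+x. g x \<partial>distr lborel borel ((+) t))"
    by (simp add: lborel_distr_plus)
  also have "\<dots> = (\<integral>\<^sup>+x. g (t + x) \<partial>lborel)"
    using assms by (intro nn_integral_distr) auto
  finally show ?thesis by (simp add: add.commute)
qed

text \<open>Unfolding: the translates of the unit square by lattice points tile the plane, so integrating
  the periodization of a function over one tile collects its integral over all tiles.\<close>
lemma nn_integral_unfold:
  fixes g :: "real^2 \<Rightarrow> ennreal"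
  assumes g [measurable]: "g \<in> borel_measurable borel"
  shows "(\<integral>\<^sup>+x. (\<Sum>n. g (x + enum_lattice n)) \<partial>square) = (\<integral>\<^sup>+x. g x \<partial>lborel)"
proof -
  have "(\<integral>\<^sup>+x. (\<Sum>n. g (x + enum_lattice n)) \<partial>square)
      = (\<integral>\<^sup>+x. (\<Sum>n. g (x + enum_lattice n) * indicator unit_square x) \<partial>lborel)"
    by (subst nn_integral_square) (auto simp: ennreal_suminf_multc)
  also have "\<dots> = (\<Sum>n. \<integral>\<^sup>+x. g (x + enum_lattice n) * indicator unit_square x \<partial>lborel)"
    by (intro nn_integral_suminf) measurable
  also have "\<dots> = (\<Sum>n. \<integral>\<^sup>+x. g x * indicator unit_square (x - enum_lattice n) \<partial>lborel)"
  proof (intro suminf_cong)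
    fix n
    show "(\<integral>\<^sup>+x. g (x + enum_lattice n) * indicator unit_square x \<partial>lborel)
       = (\<integral>\<^sup>+x. g x * indicator unit_square (x - enum_lattice n) \<partial>lborel)"
      using nn_integral_lborel_shift[of "\<lambda>x. g x * indicator unit_square (x - enum_lattice n)"
          "enum_lattice n"] by simp
  qed
  also have "\<dots> = (\<integral>\<^sup>+x. (\<Sum>n. g x * indicator unit_square (x - enum_lattice n)) \<partial>lborel)"
    by (intro nn_integral_suminf[symmetric]) measurable
  also have "\<dots> = (\<integral>\<^sup>+x. g x \<partial>lborel)"
    by (simp add: suminf_indicator_square)
  finally show ?thesis .
qed

text \<open>Translation invariance of the torus measure. The translated square is again a fundamental
  domain; unfolding \<open>f\<close> cut off to that domain gives the integral of \<open>f\<close> over the standard one.\<close>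
lemma nn_integral_square_shift:
  fixes f :: "real^2 \<Rightarrow> ennreal"
  assumes f [measurable]: "f \<in> borel_measurable borel" and per: "periodic f"
  shows "(\<integral>\<^sup>+x. f (x + t) \<partial>square) = (\<integral>\<^sup>+x. f x \<partial>square)"
proof -
  have "(\<integral>\<^sup>+x. f (x + t) \<partial>square) = (\<integral>\<^sup>+x. f (x + t) * indicator unit_square x \<partial>lborel)"
    by (intro nn_integral_square) measurable
  also have "\<dots> = (\<integral>\<^sup>+x. f x * indicator unit_square (x - t) \<partial>lborel)"
    using nn_integral_lborel_shift[of "\<lambda>x. f x * indicator unit_square (x - t)" t] by simp
  also have "\<dots> = (\<integral>\<^sup>+x. (\<Sum>n. f (x + enum_lattice n)
                    * indicator unit_square (x + enum_lattice n - t)) \<partial>square)"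
    by (intro nn_integral_unfold[symmetric]) measurable
  also have "\<dots> = (\<integral>\<^sup>+x. (\<Sum>n. f x * indicator unit_square ((x - t) + enum_lattice n)) \<partial>square)"
    using per enum_lattice_in by (simp add: periodic_def algebra_simps)
  also have "\<dots> = (\<integral>\<^sup>+x. f x \<partial>square)"
    by (simp add: suminf_indicator_square)
  finally show ?thesis .
qed

lemma emeasure_square: "emeasure lborel unit_square = 1"
proof (rule antisym)
  have one: "1 \<bullet> b = (1::real)" if b: "b \<in> Basis" for b :: "real^2"
  proof -
    obtain i where "b = axis i 1" using b by (auto simp: Basis_vec_def)
    then show ?thesis by (simp add: inner_axis)
  qed
  then have p: "(\<Prod>b\<in>Basis. (1::real^2) \<bullet> b) = 1"
    by (intro prod.neutral) blast
  have "emeasure lborel (cbox 0 (1::real^2)) = 1" "emeasure lborel (box 0 (1::real^2)) = 1"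
    unfolding emeasure_lborel_cbox_eq emeasure_lborel_box_eq using p by (auto simp: one)
  moreover have "unit_square \<subseteq> cbox 0 1" "box 0 1 \<subseteq> unit_square"
    by (auto simp: unit_square_def mem_box_cart less_imp_le)
  ultimately show "emeasure lborel unit_square \<le> 1" "1 \<le> emeasure lborel unit_square"
    using emeasure_mono[of unit_square "cbox 0 1" lborel]
      emeasure_mono[of "box 0 1" unit_square lborel] by auto
qed

lemma prob_space_square: "prob_space square"
proof (rule prob_spaceI)
  have "space square = unit_square" by (simp add: space_restrict_space)
  then show "emeasure square (space square) = 1"
    using emeasure_restrict_space[of unit_square lborel unit_square] emeasure_square by simp
qed

section \<open>Lattice endomorphisms: invariance and decorrelation\<close>

text \<open>The linear maps of the plane that descend to endomorphisms of the torus.\<close>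
definition lattice_endo :: "(real^2 \<Rightarrow> real^2) \<Rightarrow> bool" where
  "lattice_endo L \<longleftrightarrow> linear L \<and> (\<forall>z\<in>int_lattice. L z \<in> int_lattice)"

lemma lattice_endo_linear: "lattice_endo L \<Longrightarrow> linear L"
  by (simp add: lattice_endo_def)

lemma lattice_endo_measurable: "lattice_endo L \<Longrightarrow> L \<in> borel_measurable borel"
  by (intro borel_measurable_continuous_onI linear_continuous_on)
    (simp add: lattice_endo_def linear_conv_bounded_linear)

lemma emeasure_square_space [simp]: "emeasure square unit_square = 1"
  by (simp add: emeasure_restrict_space emeasure_square)

lemma space_square [simp]: "space square = unit_square"
  by (simp add: space_restrict_space)

lemma nn_integral_square_swap:
  fixes f :: "real^2 \<Rightarrow> real^2 \<Rightarrow> ennreal"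
  assumes "(\<lambda>p. f (fst p) (snd p)) \<in> borel_measurable (borel \<Otimes>\<^sub>M borel)"
  shows "(\<integral>\<^sup>+x. \<integral>\<^sup>+y. f x y \<partial>square \<partial>square) = (\<integral>\<^sup>+y. \<integral>\<^sup>+x. f x y \<partial>square \<partial>square)"
proof -
  interpret prob_space square by (rule prob_space_square)
  interpret pair_sigma_finite square square
    by unfold_locales
  have id: "(\<lambda>x. x) \<in> measurable square borel"
    by (intro measurable_restrict_space1) simp
  have "(\<lambda>p. (fst p, snd p)) \<in> measurable (square \<Otimes>\<^sub>M square) (borel \<Otimes>\<^sub>M borel)"
    by (intro measurable_Pair measurable_compose[OF measurable_fst id]
        measurable_compose[OF measurable_snd id])
  from measurable_compose[OF this assms]
  have "(\<lambda>(x, y). f x y) \<in> borel_measurable (square \<Otimes>\<^sub>M square)"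
    by (simp add: case_prod_beta)
  then show ?thesis by (rule Fubini'[symmetric])
qed

text \<open>Surjective endomorphisms preserve the torus measure. The value of the integral does not change
  when \<open>L x\<close> is moved by an arbitrary \<open>t = L t'\<close>, because this is a translation of \<open>x\<close>. Averaging
  over \<open>t\<close> in the unit square first, for fixed \<open>x\<close>, replaces the integrand by its mean.\<close>
lemma nn_integral_square_endo:
  fixes f :: "real^2 \<Rightarrow> ennreal"
  assumes f [measurable]: "f \<in> borel_measurable borel" and per: "periodic f"
    and L: "lattice_endo L" and "surj L"
  shows "(\<integral>\<^sup>+x. f (y + L x) \<partial>square) = (\<integral>\<^sup>+x. f x \<partial>square)"
proof -
  note [measurable] = lattice_endo_measurable[OF L]
  define h where "h x = f (y + L x)" for x
  have [measurable]: "h \<in> borel_measurable borel" unfolding h_def by measurable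
  have "periodic h"
    using per L by (auto simp: periodic_def h_def lattice_endo_def linear_add add.assoc[symmetric])
  then have shift: "(\<integral>\<^sup>+x. f (y + L x + t) \<partial>square) = (\<integral>\<^sup>+x. h x \<partial>square)" for t
  proof -
    obtain t' where t: "t = L t'" using \<open>surj L\<close> by (metis surj_def)
    have "(\<integral>\<^sup>+x. h (x + t') \<partial>square) = (\<integral>\<^sup>+x. h x \<partial>square)"
      by (intro nn_integral_square_shift \<open>periodic h\<close>) measurable
    then show ?thesis
      by (simp add: t h_def linear_add[OF lattice_endo_linear[OF L]] add.assoc)
  qed
  have "(\<integral>\<^sup>+x. h x \<partial>square) = (\<integral>\<^sup>+t. \<integral>\<^sup>+x. f (y + L x + t) \<partial>square \<partial>square)"
    by (simp add: shift)
  also have "\<dots> = (\<integral>\<^sup>+x. \<integral>\<^sup>+t. f (y + L x + t) \<partial>square \<partial>square)"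
    by (intro nn_integral_square_swap) measurable
  also have "\<dots> = (\<integral>\<^sup>+x. \<integral>\<^sup>+t. f (t + (y + L x)) \<partial>square \<partial>square)"
    by (simp add: algebra_simps)
  also have "\<dots> = (\<integral>\<^sup>+x. f x \<partial>square)"
    by (simp add: nn_integral_square_shift[OF f per])
  finally show ?thesis by (simp add: h_def)
qed

text \<open>The same averaging, applied to a product. Translating \<open>x\<close> by \<open>H w\<close> moves the argument of \<open>g\<close> by
  \<open>E w\<close>, which sweeps the torus uniformly as \<open>w\<close> runs through the unit square and so replaces \<open>g\<close>
  by its mean, while the argument of \<open>f\<close> moves so little that \<open>F\<close> absorbs the change.\<close>
lemma nn_integral_decorrelate:
  fixes f F g :: "real^2 \<Rightarrow> ennreal"
  assumes meas [measurable]: "f \<in> borel_measurable borel" "F \<in> borel_measurable borel"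
      "g \<in> borel_measurable borel"
    and per: "periodic f" "periodic F" "periodic g"
    and B: "lattice_endo B" "surj B" and D: "lattice_endo D" and E: "lattice_endo E" "surj E"
    and DH: "\<And>w. D (H w) = E w"
    and BH: "\<And>w y. w \<in> unit_square \<Longrightarrow> f (y + B (H w)) \<le> F y"
  shows "(\<integral>\<^sup>+x. f (B x) * g (D x) \<partial>square) \<le> (\<integral>\<^sup>+x. F x \<partial>square) * (\<integral>\<^sup>+x. g x \<partial>square)"
proof -
  note [measurable] = lattice_endo_measurable[OF B(1)] lattice_endo_measurable[OF D]
    lattice_endo_measurable[OF E(1)]
  define h where "h x = f (B x) * g (D x)" for x
  have [measurable]: "h \<in> borel_measurable borel" unfolding h_def by measurable
  have perh: "periodic h"
    using per B D by (auto simp: periodic_def h_def lattice_endo_def linear_add)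
  have "(\<integral>\<^sup>+x. h x \<partial>square) \<le> (\<integral>\<^sup>+x. F (B x) * g (D x + E w) \<partial>square)"
    if w: "w \<in> unit_square" for w
  proof -
    have "(\<integral>\<^sup>+x. h x \<partial>square) = (\<integral>\<^sup>+x. h (x + H w) \<partial>square)"
      by (intro nn_integral_square_shift[symmetric] perh) measurable
    also have "\<dots> \<le> (\<integral>\<^sup>+x. F (B x) * g (D x + E w) \<partial>square)"
      unfolding h_def linear_add[OF lattice_endo_linear[OF B(1)]]
        linear_add[OF lattice_endo_linear[OF D]] DH
      by (intro nn_integral_mono mult_right_mono BH w) simp
    finally show ?thesis .
  qed
  then have "(\<integral>\<^sup>+w. (\<integral>\<^sup>+x. h x \<partial>square) \<partial>square)
      \<le> (\<integral>\<^sup>+w. \<integral>\<^sup>+x. F (B x) * g (D x + E w) \<partial>square \<partial>square)"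
    by (rule nn_integral_mono) simp
  also have "\<dots> = (\<integral>\<^sup>+x. \<integral>\<^sup>+w. F (B x) * g (D x + E w) \<partial>square \<partial>square)"
    by (intro nn_integral_square_swap) measurable
  also have "\<dots> = (\<integral>\<^sup>+x. F (0 + B x) * (\<integral>\<^sup>+w. g w \<partial>square) \<partial>square)"
  proof (intro nn_integral_cong)
    fix x
    have "(\<integral>\<^sup>+w. F (B x) * g (D x + E w) \<partial>square) = F (B x) * (\<integral>\<^sup>+w. g (D x + E w) \<partial>square)"
      by (intro nn_integral_cmult measurable_restrict_space1) measurable
    then show "(\<integral>\<^sup>+w. F (B x) * g (D x + E w) \<partial>square) = F (0 + B x) * (\<integral>\<^sup>+w. g w \<partial>square)"
      by (simp add: nn_integral_square_endo[OF meas(3) per(3) E])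
  qed
  also have "\<dots> = (\<integral>\<^sup>+x. F (0 + B x) \<partial>square) * (\<integral>\<^sup>+w. g w \<partial>square)"
    by (intro nn_integral_multc measurable_restrict_space1) measurable
  also have "\<dots> = (\<integral>\<^sup>+x. F x \<partial>square) * (\<integral>\<^sup>+w. g w \<partial>square)"
    by (simp only: nn_integral_square_endo[OF meas(2) per(2) B])
  finally show ?thesis by (simp add: h_def)
qed

text \<open>The preimage in the plane of a ball around the origin of the torus.\<close>
definition lattice_nbhd :: "real \<Rightarrow> (real^2) set" where
  "lattice_nbhd r = {y. infdist y int_lattice < r}"

lemma measurable_lattice_nbhd [measurable]: "lattice_nbhd r \<in> sets borel"
proof -
  have "open (lattice_nbhd r)"
    unfolding lattice_nbhd_def by (intro open_Collect_less continuous_intros)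
  then show ?thesis by simp
qed

lemma periodic_lattice_nbhd: "periodic (indicator (lattice_nbhd r))"
proof -
  have "infdist (x + z) int_lattice = infdist x int_lattice" if "z \<in> int_lattice" for x z
    by (intro antisym infdist_int_lattice_shift) (simp_all add: that int_lattice_uminus)
  then show ?thesis by (simp add: periodic_def indicator_def lattice_nbhd_def)
qed

lemma lattice_nbhd_perturb:
  assumes "y + v \<in> lattice_nbhd r" "norm v \<le> e"
  shows "y \<in> lattice_nbhd (r + e)"
  using assms infdist_triangle[of y int_lattice "y + v"] by (simp add: lattice_nbhd_def dist_norm)

text \<open>A ball of the torus has at most the area of a planar disc of the same radius; for large \<open>R\<close>
  the disc overlaps its translates, and the inequality is strict.\<close>
lemma nn_integral_lattice_nbhd_le:
  assumes "R \<ge> 0"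
  shows "(\<integral>\<^sup>+x. indicator (lattice_nbhd R) x \<partial>square) \<le> ennreal (pi * R\<^sup>2)"
proof -
  have "(\<integral>\<^sup>+x. indicator (lattice_nbhd R) x \<partial>square)
      \<le> (\<integral>\<^sup>+x. (\<Sum>n. indicator (ball 0 R) (x + enum_lattice n)) \<partial>square)"
  proof (intro nn_integral_mono)
    fix y :: "real^2"
    show "indicator (lattice_nbhd R) y \<le> (\<Sum>n. indicator (ball 0 R) (y + enum_lattice n) :: ennreal)"
    proof (cases "y \<in> lattice_nbhd R")
      case True
      obtain a where a: "a \<in> int_lattice" "infdist y int_lattice = dist y a"
        using infdist_attains_inf[OF closed_int_lattice, of y] int_lattice_0 by blast
      obtain n where n: "enum_lattice n = - a"
        using enum_lattice_surj[OF int_lattice_uminus[OF a(1)]] by blast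
      have "y + enum_lattice n \<in> ball 0 R"
        using True a n by (simp add: lattice_nbhd_def dist_norm norm_minus_commute)
      then have "1 \<le> (\<Sum>n\<in>{n}. indicator (ball 0 R) (y + enum_lattice n) :: ennreal)"
        by simp
      also have "\<dots> \<le> (\<Sum>n. indicator (ball 0 R) (y + enum_lattice n) :: ennreal)"
        by (rule sum_le_suminf) auto
      finally show ?thesis using True by simp
    qed simp
  qed
  also have "\<dots> = (\<integral>\<^sup>+x. indicator (ball 0 R) (x :: real^2) \<partial>lborel)"
    by (intro nn_integral_unfold borel_measurable_indicator) simp
  also have "\<dots> = ennreal (pi * R\<^sup>2)"
    using assms by (simp add: emeasure_ball unit_ball_vol_2)
  finally show ?thesis .
qed

section \<open>Return sets on the torus\<close>

lemma space_torus_lborel [simp]: "space torus_lborel = UNIV"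
  by (simp add: torus_lborel_def)

lemma sets_torus_lborel [measurable_cong, simp]: "sets torus_lborel = sets borel"
  by (simp add: torus_lborel_def)

lemma prob_space_torus_lborel: "prob_space torus_lborel"
  unfolding torus_lborel_def
  by (rule prob_space.prob_space_distr[OF prob_space_square measurable_abs_torus2])

lemma emeasure_torus_lborel:
  assumes "S \<in> sets borel" "abs_torus2 -` S = U"
  shows "emeasure torus_lborel S = (\<integral>\<^sup>+x. indicator U x \<partial>square)"
proof -
  have "emeasure torus_lborel S = (\<integral>\<^sup>+x. indicator S x \<partial>torus_lborel)"
    using assms by simp
  also have "\<dots> = (\<integral>\<^sup>+x. indicator S (abs_torus2 x) \<partial>square)"
    unfolding torus_lborel_def
    using assms by (intro nn_integral_distr measurable_abs_torus2) simp
  also have "\<dots> = (\<integral>\<^sup>+x. indicator U x \<partial>square)"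
    using assms by (simp add: indicator_def vimage_def set_eq_iff)
  finally show ?thesis .
qed

abbreviation linear_lift :: "int^2^2 \<Rightarrow> real^2 \<Rightarrow> real^2" where
  "linear_lift A x \<equiv> map_matrix of_int A *v x"

lemma lattice_endo_linear_lift: "lattice_endo (linear_lift A)"
  by (simp add: lattice_endo_def matrix_vector_mul_linear int_lattice_matrix)

lemma lattice_endo_funpow: "lattice_endo L \<Longrightarrow> lattice_endo (L ^^ n)"
  by (induction n) (auto simp: lattice_endo_def id_def linear_ident linear_compose)

lemma lattice_endo_id_minus: "lattice_endo L \<Longrightarrow> lattice_endo (\<lambda>x. x - L x)"
  by (auto simp: lattice_endo_def int_lattice_diff linear_compose_sub linear_ident)

lemma torus_map_funpow_abs:
  "(torus_map A ^^ n) (abs_torus2 x) = abs_torus2 ((linear_lift A ^^ n) x)"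
  by (induction n) (simp_all add: torus_map.abs_eq)

text \<open>Needed for the continuity of the torus map, which makes the return sets measurable.\<close>
lemma dist_torus_map_le:
  "dist (torus_map A x) (torus_map A y) \<le> onorm (linear_lift A) * dist x y"
proof -
  obtain u v where uv: "x = abs_torus2 u" "y = abs_torus2 v"
    by (metis Quotient3_abs_rep[OF Quotient3_torus2])
  obtain a where a: "a \<in> int_lattice" "infdist (u - v) int_lattice = dist (u - v) a"
    using infdist_attains_inf[OF closed_int_lattice, of "u - v"] int_lattice_0 by blast
  have "infdist (linear_lift A u - linear_lift A v) int_lattice
      \<le> dist (linear_lift A u - linear_lift A v) (linear_lift A a)"
    by (intro infdist_le int_lattice_matrix a)
  also have "\<dots> = norm (linear_lift A (u - v - a))"
    by (simp add: dist_norm matrix_vector_mult_diff_distrib)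
  also have "\<dots> \<le> onorm (linear_lift A) * norm (u - v - a)"
    by (intro onorm) (simp add: linear_conv_bounded_linear[symmetric] matrix_vector_mul_linear)
  finally show ?thesis
    using a by (simp add: uv torus_map.abs_eq dist_torus2.abs_eq dist_norm)
qed

lemma continuous_on_torus_map_funpow: "continuous_on UNIV (torus_map A ^^ n)"
proof (induction n)
  case (Suc n)
  have "(onorm (linear_lift A))-lipschitz_on UNIV (torus_map A)"
    by (intro lipschitz_onI dist_torus_map_le onorm_pos_le)
      (simp add: linear_conv_bounded_linear[symmetric] matrix_vector_mul_linear)
  then have "continuous_on UNIV (torus_map A)"
    by (rule lipschitz_on_continuous_on)
  then show ?case
    using continuous_on_compose[OF Suc, of "torus_map A"] continuous_on_subset by fastforce
qed (simp add: id_def)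

definition return_set :: "int^2^2 \<Rightarrow> nat \<Rightarrow> real \<Rightarrow> torus2 set" where
  "return_set A n r = {x. dist x ((torus_map A ^^ n) x) < r}"

lemma measurable_return_set [measurable]: "return_set A n r \<in> sets borel"
proof -
  have "open (return_set A n r)"
    unfolding return_set_def
    by (intro open_Collect_less continuous_intros continuous_on_torus_map_funpow)
  then show ?thesis by simp
qed

lemma vimage_return_set:
  "abs_torus2 -` return_set A n r = (\<lambda>x. x - (linear_lift A ^^ n) x) -` lattice_nbhd r"
  by (simp add: return_set_def torus_map_funpow_abs dist_torus2.abs_eq lattice_nbhd_def vimage_def)

lemma emeasure_torus_ball:
  "emeasure torus_lborel (ball (abs_torus2 y) r) = (\<integral>\<^sup>+x. indicator (lattice_nbhd r) x \<partial>square)"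
proof -
  have L: "lattice_endo uminus"
    by (simp add: lattice_endo_def int_lattice_uminus linear_uminus)
  have "emeasure torus_lborel (ball (abs_torus2 y) r)
      = (\<integral>\<^sup>+x. indicator ((\<lambda>x. y + - x) -` lattice_nbhd r) x \<partial>square)"
    by (rule emeasure_torus_lborel)
      (auto simp: dist_torus2.abs_eq lattice_nbhd_def)
  also have "\<dots> = (\<integral>\<^sup>+x. indicator (lattice_nbhd r) (y + - x) \<partial>square)"
    by (simp add: indicator_def)
  also have "\<dots> = (\<integral>\<^sup>+x. indicator (lattice_nbhd r) x \<partial>square)"
    by (intro nn_integral_square_endo periodic_lattice_nbhd L surj_uminus) measurable
  finally show ?thesis .
qed

text \<open>The measure of a return set does not depend on the return time \<open>n\<close>, because \<open>I - A\<^sup>n\<close> preserves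
  the torus measure.\<close>
lemma emeasure_return_set:
  assumes "surj (\<lambda>x. x - (linear_lift A ^^ n) x)"
  shows "emeasure torus_lborel (return_set A n r) = (\<integral>\<^sup>+x. indicator (lattice_nbhd r) x \<partial>square)"
proof -
  have "emeasure torus_lborel (return_set A n r)
      = (\<integral>\<^sup>+x. indicator (lattice_nbhd r) (0 + (x - (linear_lift A ^^ n) x)) \<partial>square)"
    by (simp add: emeasure_torus_lborel[OF _ vimage_return_set] indicator_def)
  also have "\<dots> = (\<integral>\<^sup>+x. indicator (lattice_nbhd r) x \<partial>square)"
    by (intro nn_integral_square_endo[where L = "\<lambda>x. x - (linear_lift A ^^ n) x"]
        periodic_lattice_nbhd lattice_endo_id_minus lattice_endo_funpow
        lattice_endo_linear_lift assms) measurable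
  finally show ?thesis .
qed

section \<open>Hyperbolic splitting of the plane\<close>

lemma norm_unit_square: "w \<in> unit_square \<Longrightarrow> norm w \<le> 2"
  using norm_le_l1_cart[of w] by (simp add: sum_2 unit_square_def forall_2)

text \<open>The maps \<open>P\<close> and \<open>Q\<close> are the projections onto the eigenlines of \<open>L\<close>, along which it expands by
  \<open>\<alpha>\<close> and contracts by \<open>\<beta>\<close>. Every rational function of \<open>L\<close> without a pole at \<open>\<alpha>\<close> or \<open>\<beta>\<close> then acts as
  a combination \<open>a P + b Q\<close>; in particular inverses can be written down explicitly.\<close>

locale hyperbolic_map =
  fixes L :: "real^2 \<Rightarrow> real^2" and \<alpha> \<beta> :: real and P Q :: "real^2 \<Rightarrow> real^2"
  assumes expanding: "1 < \<bar>\<alpha>\<bar>" and unimodular: "\<bar>\<alpha>\<bar> * \<bar>\<beta>\<bar> = 1"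
    and linear_L: "linear L" and linear_P: "linear P" and linear_Q: "linear Q"
    and decompose: "P x + Q x = x"
    and eigen_P: "L (P x) = \<alpha> *\<^sub>R P x" and eigen_Q: "L (Q x) = \<beta> *\<^sub>R Q x"
begin

lemma contracting: "0 < \<bar>\<beta>\<bar>" "\<bar>\<beta>\<bar> < 1"
proof -
  show *: "0 < \<bar>\<beta>\<bar>" using unimodular by fastforce
  have "\<bar>\<beta>\<bar> < \<bar>\<alpha>\<bar> * \<bar>\<beta>\<bar>" using expanding * by simp
  then show "\<bar>\<beta>\<bar> < 1" by (simp add: unimodular)
qed

lemma linear_funpow: "linear (L ^^ n)"
  by (induction n) (auto simp: id_def linear_ident linear_L linear_compose[unfolded o_def])

lemma funpow_eigen:
  "(L ^^ n) (a *\<^sub>R P x + b *\<^sub>R Q x) = (\<alpha> ^ n * a) *\<^sub>R P x + (\<beta> ^ n * b) *\<^sub>R Q x"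
proof -
  have "(L ^^ n) (P x) = \<alpha> ^ n *\<^sub>R P x" "(L ^^ n) (Q x) = \<beta> ^ n *\<^sub>R Q x"
    by (induction n) (simp_all add: eigen_P eigen_Q linear_scale[OF linear_L] mult.commute)
  then show ?thesis
    by (simp add: linear_add[OF linear_funpow] linear_scale[OF linear_funpow] mult.commute)
qed

lemma power_neq_1: "n \<ge> 1 \<Longrightarrow> \<alpha> ^ n \<noteq> 1" "n \<ge> 1 \<Longrightarrow> \<beta> ^ n \<noteq> 1"
proof -
  assume n: "n \<ge> 1"
  have "\<bar>\<alpha>\<bar> ^ n > 1" using n expanding by (intro one_less_power) auto
  then show "\<alpha> ^ n \<noteq> 1" by (metis abs_1 less_irrefl power_abs)
  have "\<bar>\<beta>\<bar> ^ n < 1" using n contracting power_Suc_less_one[of "\<bar>\<beta>\<bar>" "n - 1"] by simp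
  then show "\<beta> ^ n \<noteq> 1" by (metis abs_1 less_irrefl power_abs)
qed

lemma surj_funpow: "surj (L ^^ n)"
proof -
  have "\<alpha> \<noteq> 0" "\<beta> \<noteq> 0" using expanding contracting by auto
  then have "(L ^^ n) ((1 / \<alpha> ^ n) *\<^sub>R P y + (1 / \<beta> ^ n) *\<^sub>R Q y) = y" for y
    by (simp add: funpow_eigen decompose)
  then show ?thesis unfolding surj_def by metis
qed

lemma id_minus_funpow_eigen:
  "(a *\<^sub>R P x + b *\<^sub>R Q x) - (L ^^ n) (a *\<^sub>R P x + b *\<^sub>R Q x)
    = ((1 - \<alpha> ^ n) * a) *\<^sub>R P x + ((1 - \<beta> ^ n) * b) *\<^sub>R Q x"
  unfolding funpow_eigen by (simp add: algebra_simps)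

lemma surj_id_minus_funpow:
  assumes "n \<ge> 1"
  shows "surj (\<lambda>x. x - (L ^^ n) x)"
proof -
  have "v - (L ^^ n) v = y" if "v = (1 / (1 - \<alpha> ^ n)) *\<^sub>R P y + (1 / (1 - \<beta> ^ n)) *\<^sub>R Q y" for y v
    unfolding that id_minus_funpow_eigen using power_neq_1[OF assms] by (simp add: decompose)
  then show ?thesis unfolding surj_def by metis
qed

text \<open>The factors by which \<open>(I - L\<^sup>j) (I - L\<^sup>k)\<^sup>-\<^sup>1 L\<^sup>q\<close> acts on the two eigenlines. On the expanding line
  the factor is of order \<open>\<bar>\<alpha>\<bar>\<^bsup>j + q - k\<^esup>\<close>, which improves with smaller \<open>q\<close>; on the contracting line it
  is of order \<open>\<bar>\<beta>\<bar>\<^sup>q\<close>, which improves with larger \<open>q\<close>. The choice of \<open>q\<close> balances the two.\<close>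
lemma multipliers_bound:
  assumes "1 \<le> j" "j < k" and q: "q = (k - j) div 2"
  shows "\<bar>(1 - \<alpha> ^ j) * (\<alpha> ^ q / (1 - \<alpha> ^ k))\<bar> \<le> 2 / (1 - \<bar>\<beta>\<bar>) * \<bar>\<beta>\<bar> ^ q" (is ?A)
    and "\<bar>(1 - \<beta> ^ j) * (\<beta> ^ q / (1 - \<beta> ^ k))\<bar> \<le> 2 / (1 - \<bar>\<beta>\<bar>) * \<bar>\<beta>\<bar> ^ q" (is ?B)
proof -
  define l m where "l = \<bar>\<alpha>\<bar>" and "m = \<bar>\<beta>\<bar>"
  have l: "l > 1" and m: "0 < m" "m < 1" and lm: "l * m = 1"
    using expanding contracting unimodular by (simp_all add: l_def m_def)
  have lmn: "l ^ n * m ^ n = 1" for n by (simp add: lm flip: power_mult_distrib)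
  have mk: "m ^ k \<le> m" using assms m power_decreasing[of 1 k m] by simp
  show ?A
  proof -
    have "\<bar>1 - \<alpha> ^ j\<bar> \<le> 1 + l ^ j"
      using abs_triangle_ineq4[of 1 "\<alpha> ^ j"] by (simp add: l_def power_abs)
    also have "\<dots> \<le> 2 * l ^ j" using l one_le_power[of l j] by simp
    finally have num: "\<bar>1 - \<alpha> ^ j\<bar> * l ^ q \<le> 2 * l ^ j * l ^ q"
      using l by (intro mult_right_mono) auto
    have "l ^ k * (1 - m) \<le> l ^ k * (1 - m ^ k)" using mk l by (intro mult_left_mono) auto
    also have "\<dots> = l ^ k - 1" by (simp add: algebra_simps lmn)
    also have "\<dots> \<le> \<bar>1 - \<alpha> ^ k\<bar>" by (simp add: l_def flip: power_abs)
    finally have den: "l ^ k * (1 - m) \<le> \<bar>1 - \<alpha> ^ k\<bar>" .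
    have "l ^ (j + q + q) \<le> l ^ k" using l assms by (intro power_increasing) auto
    then have "l ^ j * l ^ q \<le> l ^ k * m ^ q"
      using mult_right_mono[of "l ^ (j + q + q)" "l ^ k" "m ^ q"] m
      by (simp add: power_add mult.assoc lmn)
    then have "(l ^ j * l ^ q) / l ^ k \<le> m ^ q"
      using l by (simp add: divide_le_eq mult.commute)
    then have "2 / (1 - m) * ((l ^ j * l ^ q) / l ^ k) \<le> 2 / (1 - m) * m ^ q"
      using m by (intro mult_left_mono) auto
    then have "2 * l ^ j * l ^ q / (l ^ k * (1 - m)) \<le> 2 / (1 - m) * m ^ q"
      by (simp add: mult_ac)
    moreover have "\<bar>1 - \<alpha> ^ j\<bar> * l ^ q / \<bar>1 - \<alpha> ^ k\<bar> \<le> 2 * l ^ j * l ^ q / (l ^ k * (1 - m))"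
      using num den l m by (intro frac_le) auto
    ultimately show ?thesis
      by (simp add: abs_mult power_abs l_def m_def)
  qed
  show ?B
  proof -
    have "\<bar>1 - \<beta> ^ j\<bar> \<le> 1 + m ^ j"
      using abs_triangle_ineq4[of 1 "\<beta> ^ j"] by (simp add: m_def power_abs)
    also have "\<dots> \<le> 2" using m power_le_one[of m j] by simp
    finally have num: "\<bar>1 - \<beta> ^ j\<bar> * m ^ q \<le> 2 * m ^ q"
      using m by (intro mult_right_mono) auto
    have "1 - m \<le> \<bar>1 - \<beta> ^ k\<bar>"
      using mk abs_ge_self[of "\<beta> ^ k"] by (simp add: m_def power_abs)
    then have "\<bar>1 - \<beta> ^ j\<bar> * m ^ q / \<bar>1 - \<beta> ^ k\<bar> \<le> 2 * m ^ q / (1 - m)"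
      using num m by (intro frac_le) auto
    then show ?thesis
      by (simp add: abs_mult power_abs m_def)
  qed
qed

text \<open>The translations used for decorrelation: \<open>H = (I - L\<^sup>k)\<^sup>-\<^sup>1 L\<^sup>q\<close> turns the displacement of
  \<open>(I - L\<^sup>k) x\<close> into \<open>L\<^sup>q w\<close>, at the cost of an exponentially small displacement of
  \<open>(I - L\<^sup>j) x\<close>.\<close>
lemma steering_vectors:
  obtains C where "C > 0" and "\<And>j k. 1 \<le> j \<Longrightarrow> j < k \<Longrightarrow>
    \<exists>H. (\<forall>w. H w - (L ^^ k) (H w) = (L ^^ ((k - j) div 2)) w) \<and>
        (\<forall>w\<in>unit_square. norm (H w - (L ^^ j) (H w)) \<le> C * \<bar>\<beta>\<bar> ^ ((k - j) div 2))"
proof -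
  have "bounded_linear P" "bounded_linear Q"
    using linear_P linear_Q by (simp_all add: linear_conv_bounded_linear)
  from bounded_linear.nonneg_bounded[OF this(1)] bounded_linear.nonneg_bounded[OF this(2)]
  obtain K1 K2 where K: "K1 \<ge> 0" "K2 \<ge> 0"
    "\<And>x. norm (P x) \<le> norm x * K1" "\<And>x. norm (Q x) \<le> norm x * K2" by blast
  define C where "C = 2 / (1 - \<bar>\<beta>\<bar>) * (2 * K1 + 2 * K2 + 1)"
  show thesis
  proof
    show "C > 0" using contracting K by (simp add: C_def)
    fix j k :: nat assume jk: "1 \<le> j" "j < k"
    define q where "q = (k - j) div 2"
    define H where "H w = (\<alpha> ^ q / (1 - \<alpha> ^ k)) *\<^sub>R P w + (\<beta> ^ q / (1 - \<beta> ^ k)) *\<^sub>R Q w" for w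
    have "H w - (L ^^ k) (H w) = (L ^^ q) w" for w
    proof -
      have "H w - (L ^^ k) (H w) = \<alpha> ^ q *\<^sub>R P w + \<beta> ^ q *\<^sub>R Q w"
        unfolding H_def id_minus_funpow_eigen using power_neq_1[of k] jk by simp
      also have "\<dots> = (L ^^ q) w"
        using funpow_eigen[of q 1 w 1] by (simp add: decompose)
      finally show ?thesis .
    qed
    moreover have "norm (H w - (L ^^ j) (H w)) \<le> C * \<bar>\<beta>\<bar> ^ q" if w: "w \<in> unit_square" for w
    proof -
      let ?b = "2 / (1 - \<bar>\<beta>\<bar>) * \<bar>\<beta>\<bar> ^ q"
      have b: "?b \<ge> 0" using contracting by simp
      have PQ: "norm (P w) \<le> 2 * K1" "norm (Q w) \<le> 2 * K2"
        using order_trans[OF K(3)[of w] mult_right_mono[OF norm_unit_square[OF w] K(1)]]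
          order_trans[OF K(4)[of w] mult_right_mono[OF norm_unit_square[OF w] K(2)]] by auto
      have "norm (H w - (L ^^ j) (H w))
          \<le> \<bar>(1 - \<alpha> ^ j) * (\<alpha> ^ q / (1 - \<alpha> ^ k))\<bar> * norm (P w)
            + \<bar>(1 - \<beta> ^ j) * (\<beta> ^ q / (1 - \<beta> ^ k))\<bar> * norm (Q w)"
        unfolding H_def id_minus_funpow_eigen by (rule norm_triangle_le) simp
      also have "\<dots> \<le> ?b * (2 * K1) + ?b * (2 * K2)"
        using multipliers_bound[OF jk q_def] PQ b
        by (intro add_mono mult_mono) auto
      also have "\<dots> \<le> ?b * (2 * K1 + 2 * K2 + 1)"
        unfolding distrib_left mult_1_right using b by linarith
      also have "\<dots> = C * \<bar>\<beta>\<bar> ^ q"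
        unfolding C_def by (simp only: mult_ac)
      finally show ?thesis .
    qed
    ultimately show "\<exists>H. (\<forall>w. H w - (L ^^ k) (H w) = (L ^^ ((k - j) div 2)) w) \<and>
        (\<forall>w\<in>unit_square. norm (H w - (L ^^ j) (H w)) \<le> C * \<bar>\<beta>\<bar> ^ ((k - j) div 2))"
      unfolding q_def by blast
  qed
qed

end

text \<open>An eigenvector for a root \<open>c\<close> of the characteristic polynomial is read off from a nonzero
  column of the adjugate of \<open>A - c I\<close>; if there is none, \<open>A\<close> is the scalar matrix \<open>c I\<close>.\<close>
lemma matrix_eigenvalue_charpoly:
  fixes A :: "'a::field^2^2"
  assumes "c * c - (A$1$1 + A$2$2) * c + (A$1$1 * A$2$2 - A$1$2 * A$2$1) = 0"
  shows "matrix_eigenvalue A c"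
proof -
  have eig: "matrix_eigenvalue A c"
    if "v \<noteq> 0" "A$1$1 * v$1 + A$1$2 * v$2 = c * v$1" "A$2$1 * v$1 + A$2$2 * v$2 = c * v$2" for v :: "'a^2"
    using that unfolding matrix_eigenvalue_def
    by (intro exI[of _ v]) (simp add: vec_eq_iff forall_2 matrix_vector_mult_def sum_2)
  consider "A$1$2 \<noteq> 0 \<or> c \<noteq> A$1$1" | "A$2$1 \<noteq> 0 \<or> c \<noteq> A$2$2"
    | "A$1$2 = 0" "c = A$1$1" "A$2$1 = 0" "c = A$2$2" by blast
  then show ?thesis
  proof cases
    case 1
    have "(vector [A$1$2, c - A$1$1] :: 'a^2) \<noteq> 0"
      using 1 by (auto simp: vec_eq_iff forall_2)
    then show ?thesis
      by (rule eig) (use assms in \<open>simp_all add: algebra_simps\<close>)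
  next
    case 2
    have "(vector [c - A$2$2, A$2$1] :: 'a^2) \<noteq> 0"
      using 2 by (auto simp: vec_eq_iff forall_2)
    then show ?thesis
      by (rule eig) (use assms in \<open>simp_all add: algebra_simps\<close>)
  next
    case 3
    have "(vector [1, 0] :: 'a^2) \<noteq> 0"
      by (auto simp: vec_eq_iff forall_2)
    then show ?thesis
      by (rule eig) (use 3 in simp_all)
  qed
qed

text \<open>If the discriminant of the characteristic polynomial were not positive, then \<open>det A = 1\<close> and the
  roots would be complex conjugates (possibly equal) of product one, hence of modulus one. So there are two distinct
  real roots, neither of modulus one, with product \<open>\<plusminus>1\<close>; the Cayley-Hamilton identity provides the
  projections.\<close>
lemma hyperbolic_map_linear_lift:
  fixes A :: "int^2^2"
  assumes det_A: "\<bar>det A\<bar> = 1"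
    and hyp: "\<And>c. matrix_eigenvalue (map_matrix of_int A :: complex^2^2) c \<Longrightarrow> cmod c \<noteq> 1"
  obtains \<alpha> \<beta> P Q where "hyperbolic_map (linear_lift A) \<alpha> \<beta> P Q"
proof -
  note result = that
  define t where "t = (of_int (A$1$1 + A$2$2) :: real)"
  define d where "d = (of_int (A$1$1 * A$2$2 - A$1$2 * A$2$1) :: real)"
  have d: "\<bar>d\<bar> = 1"
    using det_A unfolding d_def det_2 by linarith
  have unit: "cmod c \<noteq> 1" if "c * c - of_real t * c + of_real d = 0" for c
    by (intro hyp matrix_eigenvalue_charpoly) (use that in \<open>simp add: t_def d_def\<close>)
  have disc: "t\<^sup>2 - 4 * d > 0"
  proof (rule ccontr)
    assume "\<not> t\<^sup>2 - 4 * d > 0"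
    then have le: "t\<^sup>2 \<le> 4 * d" by simp
    then have "d = 1" using d zero_le_power2[of t] by linarith
    define c where "c = Complex (t / 2) (sqrt (4 - t\<^sup>2) / 2)"
    have sq: "sqrt (4 - t\<^sup>2) * sqrt (4 - t\<^sup>2) = 4 - t\<^sup>2" using le \<open>d = 1\<close> by simp
    have "c * c - of_real t * c + of_real d = 0"
      using sq by (simp add: complex_eq_iff c_def \<open>d = 1\<close> power2_eq_square field_simps)
    moreover have "cmod c = 1"
      using sq by (simp add: c_def cmod_def power_divide power2_eq_square field_simps)
    ultimately show False using unit by blast
  qed
  have main: thesis if roots: "\<alpha> + \<beta> = t" "\<alpha> * \<beta> = d" "1 < \<bar>\<alpha>\<bar>" "\<alpha> \<noteq> \<beta>" for \<alpha> \<beta>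
  proof -
    let ?L = "linear_lift A"
    have lin: "linear ?L" by (simp add: matrix_vector_mul_linear)
    have cayley: "?L (?L x) = t *\<^sub>R ?L x - d *\<^sub>R x" for x
      by (simp add: vec_eq_iff forall_2 matrix_vector_mult_def sum_2 t_def d_def algebra_simps)
    define P where "P x = (1 / (\<alpha> - \<beta>)) *\<^sub>R (?L x - \<beta> *\<^sub>R x)" for x
    define Q where "Q x = (1 / (\<alpha> - \<beta>)) *\<^sub>R (\<alpha> *\<^sub>R x - ?L x)" for x
    have "linear P" "linear Q"
      unfolding P_def Q_def using lin
      by (auto intro!: linearI simp: linear_add linear_scale algebra_simps)
    moreover have "P x + Q x = x" for x
    proof -
      have "P x + Q x = (1 / (\<alpha> - \<beta>)) *\<^sub>R ((\<alpha> - \<beta>) *\<^sub>R x)"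
        unfolding P_def Q_def scaleR_add_right[symmetric] by (simp add: algebra_simps)
      then show ?thesis using roots(4) by simp
    qed
    moreover have "?L (P x) = \<alpha> *\<^sub>R P x" for x
    proof -
      have "?L (?L x - \<beta> *\<^sub>R x) = \<alpha> *\<^sub>R (?L x - \<beta> *\<^sub>R x)"
        unfolding linear_diff[OF lin] linear_scale[OF lin] cayley roots(1,2)[symmetric]
        by (simp add: algebra_simps)
      then show ?thesis by (simp add: P_def linear_scale[OF lin] mult.commute)
    qed
    moreover have "?L (Q x) = \<beta> *\<^sub>R Q x" for x
    proof -
      have "?L (\<alpha> *\<^sub>R x - ?L x) = \<beta> *\<^sub>R (\<alpha> *\<^sub>R x - ?L x)"
        unfolding linear_diff[OF lin] linear_scale[OF lin] cayley roots(1,2)[symmetric]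
        by (simp add: algebra_simps)
      then show ?thesis by (simp add: Q_def linear_scale[OF lin] mult.commute)
    qed
    moreover have "\<bar>\<alpha>\<bar> * \<bar>\<beta>\<bar> = 1" using d roots(2) by (simp flip: abs_mult)
    ultimately have "hyperbolic_map ?L \<alpha> \<beta> P Q"
      using roots(3) lin by (simp add: hyperbolic_map_def)
    then show thesis by (rule result)
  qed
  define s where "s = sqrt (t\<^sup>2 - 4 * d)"
  have s: "s > 0" "s * s = t * t - 4 * d"
    using disc by (simp_all add: s_def power2_eq_square)
  define a where "a = (t + s) / 2"
  define b where "b = (t - s) / 2"
  have ab: "a + b = t" "a * b = d" "a \<noteq> b"
    using s by (simp_all add: a_def b_def field_simps)
  have "a * a - t * a + d = 0" unfolding ab(1,2)[symmetric] by (simp add: algebra_simps)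
  then have "of_real a * of_real a - of_real t * of_real a + of_real d = (0::complex)"
    by (metis of_real_0 of_real_add of_real_diff of_real_mult)
  from unit[OF this] have a1: "\<bar>a\<bar> \<noteq> 1" by simp
  show thesis
  proof (cases "\<bar>a\<bar> > 1")
    case True
    then show ?thesis using ab by (intro main[of a b])
  next
    case False
    have "\<bar>a\<bar> * \<bar>b\<bar> = 1" using ab(2) d by (simp flip: abs_mult)
    moreover have "\<bar>a\<bar> * \<bar>b\<bar> \<le> \<bar>a\<bar>" if "\<bar>b\<bar> \<le> 1"
      using mult_left_mono[OF that, of "\<bar>a\<bar>"] by simp
    ultimately have "\<bar>b\<bar> > 1" using a1 False by force
    then show ?thesis using ab by (intro main[of b a]) (auto simp: algebra_simps)
  qed
qed

section \<open>Quasi-independence of the return sets\<close>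

text \<open>The radius \<open>r\<close> of the earlier return is enlarged by the displacement that decorrelation costs.
  Where the ball of radius \<open>r\<close> has area \<open>pi * r\<^sup>2\<close>, the bound therefore tends to the product of the
  measures of the two sets as \<open>k - j\<close> grows, at an exponential rate.\<close>
lemma return_sets_quasi_independent:
  fixes A :: "int^2^2"
  assumes det_A: "\<bar>det A\<bar> = 1"
    and hyp: "\<And>c. matrix_eigenvalue (map_matrix of_int A :: complex^2^2) c \<Longrightarrow> cmod c \<noteq> 1"
  obtains C \<theta> where "C > 0" "0 < \<theta>" "\<theta> < 1"
    and "\<And>k r y. 1 \<le> k \<Longrightarrow>
      measure torus_lborel (return_set A k r) = measure torus_lborel (ball y r)"
    and "\<And>j k r s. 1 \<le> j \<Longrightarrow> j < k \<Longrightarrow> 0 \<le> r \<Longrightarrow>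
      measure torus_lborel (return_set A j r \<inter> return_set A k s)
        \<le> pi * (r + C * \<theta> ^ (k - j))\<^sup>2 * measure torus_lborel (return_set A k s)"
proof -
  interpret T: prob_space torus_lborel by (rule prob_space_torus_lborel)
  obtain \<alpha> \<beta> P Q where "hyperbolic_map (linear_lift A) \<alpha> \<beta> P Q"
    using hyperbolic_map_linear_lift[OF det_A hyp] by blast
  then interpret hyperbolic_map "linear_lift A" \<alpha> \<beta> P Q .
  define D where "D n x = x - (linear_lift A ^^ n) x" for n x
  have endoD: "lattice_endo (D n)" for n
    unfolding D_def by (intro lattice_endo_id_minus lattice_endo_funpow lattice_endo_linear_lift)
  have surjD: "surj (D n)" if "1 \<le> n" for n
    unfolding D_def by (rule surj_id_minus_funpow[OF that])
  have em: "emeasure torus_lborel (return_set A n r)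
      = (\<integral>\<^sup>+x. indicator (lattice_nbhd r) x \<partial>square)" if "1 \<le> n" for n r
    using surjD[OF that] by (intro emeasure_return_set) (simp add: D_def)
  obtain C where "C > 0" and C: "\<And>j k. 1 \<le> j \<Longrightarrow> j < k \<Longrightarrow>
    \<exists>H. (\<forall>w. D k (H w) = (linear_lift A ^^ ((k - j) div 2)) w) \<and>
        (\<forall>w\<in>unit_square. norm (D j (H w)) \<le> C * \<bar>\<beta>\<bar> ^ ((k - j) div 2))"
    unfolding D_def by (rule steering_vectors) blast
  define \<theta> where "\<theta> = sqrt \<bar>\<beta>\<bar>"
  have \<theta>: "0 < \<theta>" "\<theta> < 1" "\<bar>\<beta>\<bar> = \<theta>\<^sup>2"
    using contracting by (simp_all add: \<theta>_def)
  show thesis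
  proof (rule that[of "C / \<theta>" \<theta>])
    show "C / \<theta> > 0" using \<open>C > 0\<close> \<theta> by simp
    show "0 < \<theta>" "\<theta> < 1" by (fact \<theta>)+
    show "measure torus_lborel (return_set A k r) = measure torus_lborel (ball y r)"
      if "1 \<le> k" for k r y
    proof -
      obtain v where "y = abs_torus2 v"
        by (metis Quotient3_abs_rep[OF Quotient3_torus2])
      then show ?thesis
        using em[OF that, of r] emeasure_torus_ball[of v r] by (simp add: measure_def)
    qed
    fix j k :: nat and r s :: real
    assume jk: "1 \<le> j" "j < k" and r: "0 \<le> r"
    define q where "q = (k - j) div 2"
    define e where "e = C / \<theta> * \<theta> ^ (k - j)"
    have "e \<ge> 0" using \<open>C > 0\<close> \<theta> by (simp add: e_def)
    obtain H where H: "\<And>w. D k (H w) = (linear_lift A ^^ q) w"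
      and H': "\<And>w. w \<in> unit_square \<Longrightarrow> norm (D j (H w)) \<le> C * \<bar>\<beta>\<bar> ^ q"
      using C[OF jk] unfolding q_def by blast
    have "\<theta> ^ (2 * q + 1) \<le> \<theta> ^ (k - j)"
      using \<theta> by (intro power_decreasing) (auto simp: q_def)
    then have "\<bar>\<beta>\<bar> ^ q \<le> \<theta> ^ (k - j) / \<theta>"
      using \<theta> by (simp add: le_divide_eq power_mult[symmetric] mult.commute)
    then have small: "C * \<bar>\<beta>\<bar> ^ q \<le> e"
      using mult_left_mono[of "\<bar>\<beta>\<bar> ^ q" "\<theta> ^ (k - j) / \<theta>" C] \<open>C > 0\<close> by (simp add: e_def)
    have "emeasure torus_lborel (return_set A j r \<inter> return_set A k s)
        = (\<integral>\<^sup>+x. indicator (lattice_nbhd r) (D j x) * indicator (lattice_nbhd s) (D k x) \<partial>square)"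
    proof -
      have "abs_torus2 -` (return_set A j r \<inter> return_set A k s)
          = D j -` lattice_nbhd r \<inter> D k -` lattice_nbhd s"
        by (simp add: vimage_Int vimage_return_set D_def [abs_def])
      moreover have "return_set A j r \<inter> return_set A k s \<in> sets borel" by measurable
      ultimately show ?thesis
        by (simp add: emeasure_torus_lborel indicator_inter_arith indicator_vimage)
    qed
    also have "\<dots> \<le> (\<integral>\<^sup>+x. indicator (lattice_nbhd (r + e)) x \<partial>square)
        * (\<integral>\<^sup>+x. indicator (lattice_nbhd s) x \<partial>square)"
    proof (rule nn_integral_decorrelate[where E = "linear_lift A ^^ q" and H = H])
      show "surj (D j)" "lattice_endo (D j)" "lattice_endo (D k)"
        by (fact surjD[OF jk(1)] endoD)+
      show "lattice_endo (linear_lift A ^^ q)"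
        by (intro lattice_endo_funpow lattice_endo_linear_lift)
      show "surj (linear_lift A ^^ q)" by (rule surj_funpow)
      show "D k (H w) = (linear_lift A ^^ q) w" for w by (rule H)
      show "indicator (lattice_nbhd r) (y + D j (H w)) \<le> (indicator (lattice_nbhd (r + e)) y :: ennreal)"
        if "w \<in> unit_square" for w y
        using lattice_nbhd_perturb[of y "D j (H w)" r e] order_trans[OF H'[OF that] small]
        by (simp add: indicator_def)
    qed (simp_all add: periodic_lattice_nbhd)
    also have "\<dots> \<le> ennreal (pi * (r + e)\<^sup>2) * emeasure torus_lborel (return_set A k s)"
      using jk r \<open>e \<ge> 0\<close> by (intro mult_mono nn_integral_lattice_nbhd_le) (simp_all add: em)
    finally have "ennreal (measure torus_lborel (return_set A j r \<inter> return_set A k s))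
        \<le> ennreal (pi * (r + e)\<^sup>2 * measure torus_lborel (return_set A k s))"
      by (simp add: T.emeasure_eq_measure ennreal_mult)
    then show "measure torus_lborel (return_set A j r \<inter> return_set A k s)
        \<le> pi * (r + C / \<theta> * \<theta> ^ (k - j))\<^sup>2 * measure torus_lborel (return_set A k s)"
      by (simp add: e_def)
  qed
qed

section \<open>Strong law with error term for quasi-independent events\<close>

text \<open>Expanding the square, a pair \<open>j < k\<close> contributes at most \<open>c (k - j) * a k\<close>. The error is charged
  to the later index, so summing over the earlier one costs only the total mass of \<open>c\<close>.\<close>
lemma (in prob_space) quasi_independent_variance:
  fixes E :: "nat \<Rightarrow> 'a set" and a c :: "nat \<Rightarrow> real"
  assumes E [measurable]: "\<And>k. E k \<in> events"
    and prob_E: "\<And>k. 1 \<le> k \<Longrightarrow> prob (E k) = a k"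
    and pair: "\<And>j k. 1 \<le> j \<Longrightarrow> j < k \<Longrightarrow> prob (E j \<inter> E k) \<le> a j * a k + c (k - j) * a k"
    and c: "\<And>d. 0 \<le> c d" "summable c"
  shows "expectation (\<lambda>x. (\<Sum>k\<in>{m<..n}. indicator (E k) x - a k)\<^sup>2)
    \<le> (1 + 2 * suminf c) * (\<Sum>k\<in>{m<..n}. a k)"
proof -
  let ?J = "{m<..n}"
  have a: "0 \<le> a k" if "k \<in> ?J" for k
    using that prob_E[of k, symmetric] by simp
  define b where "b j k = (if j = k then a k else 0) + (if j < k then c (k - j) * a k else 0)
      + (if k < j then c (j - k) * a j else 0)" for j k
  have prod: "(indicator (E j) x - a j) * (indicator (E k) x - a k)
      = indicator (E j \<inter> E k) x - a k * indicator (E j) x - a j * indicator (E k) x + a j * a k"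
    for j k x by (simp add: indicator_inter_arith algebra_simps)
  have ind: "integrable M (\<lambda>x. indicator (E k) x :: real)"
    "integrable M (\<lambda>x. indicator (E j \<inter> E k) x :: real)" for j k
    by (auto intro!: integrable_real_indicator simp: emeasure_eq_measure)
  have int: "integrable M (\<lambda>x. (indicator (E j) x - a j) * (indicator (E k) x - a k))" for j k
    unfolding prod by (intro Bochner_Integration.integrable_add Bochner_Integration.integrable_diff
        integrable_mult_right integrable_const ind)
  have cov: "expectation (\<lambda>x. (indicator (E j) x - a j) * (indicator (E k) x - a k)) \<le> b j k"
    if jk: "j \<in> ?J" "k \<in> ?J" for j k
  proof -
    have "expectation (\<lambda>x. (indicator (E j) x - a j) * (indicator (E k) x - a k))
        = prob (E j \<inter> E k) - a j * a k"
      unfolding prod using jk prob_E[of j] prob_E[of k] by (simp add: ind prob_space)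
    also have "\<dots> \<le> b j k"
      using pair[of j k] pair[of k j] prob_E[of k] jk
      by (cases j k rule: linorder_cases) (auto simp: b_def Int_commute mult.commute)
    finally show ?thesis .
  qed
  have row: "(\<Sum>j\<in>?J. if j < k then c (k - j) * a k else 0) \<le> suminf c * a k" if k: "k \<in> ?J" for k
  proof -
    have "(\<Sum>j\<in>?J. if j < k then c (k - j) * a k else 0) = (\<Sum>j\<in>{j\<in>?J. j < k}. c (k - j)) * a k"
      by (subst sum.inter_filter) (auto simp: sum_distrib_right intro!: sum.cong)
    also have "(\<Sum>j\<in>{j\<in>?J. j < k}. c (k - j)) = sum c ((\<lambda>j. k - j) ` {j\<in>?J. j < k})"
      by (intro sum.reindex[symmetric, unfolded o_def]) (auto simp: inj_on_def)
    also have "\<dots> * a k \<le> suminf c * a k"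
      using c a[OF k] by (intro mult_right_mono sum_le_suminf) auto
    finally show ?thesis .
  qed
  have "expectation (\<lambda>x. (\<Sum>k\<in>?J. indicator (E k) x - a k)\<^sup>2)
      = expectation (\<lambda>x. \<Sum>j\<in>?J. \<Sum>k\<in>?J. (indicator (E j) x - a j) * (indicator (E k) x - a k))"
    by (simp only: power2_eq_square sum_product)
  also have "\<dots> = (\<Sum>j\<in>?J. \<Sum>k\<in>?J. expectation (\<lambda>x. (indicator (E j) x - a j) * (indicator (E k) x - a k)))"
    by (simp only: Bochner_Integration.integral_sum Bochner_Integration.integrable_sum int)
  also have "\<dots> \<le> (\<Sum>j\<in>?J. \<Sum>k\<in>?J. b j k)"
    by (intro sum_mono cov)
  also have "\<dots> = (\<Sum>j\<in>?J. \<Sum>k\<in>?J. if j = k then a k else 0)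
      + (\<Sum>j\<in>?J. \<Sum>k\<in>?J. if j < k then c (k - j) * a k else 0)
      + (\<Sum>j\<in>?J. \<Sum>k\<in>?J. if k < j then c (j - k) * a j else 0)"
    by (simp only: b_def sum.distrib)
  also have "(\<Sum>j\<in>?J. \<Sum>k\<in>?J. if j < k then c (k - j) * a k else 0)
      = (\<Sum>k\<in>?J. \<Sum>j\<in>?J. if j < k then c (k - j) * a k else 0)"
    by (rule sum.swap)
  also have "(\<Sum>j\<in>?J. \<Sum>k\<in>?J. if j = k then a k else 0)
      + (\<Sum>k\<in>?J. \<Sum>j\<in>?J. if j < k then c (k - j) * a k else 0)
      + (\<Sum>j\<in>?J. \<Sum>k\<in>?J. if k < j then c (j - k) * a j else 0)
    \<le> (\<Sum>k\<in>?J. a k) + (\<Sum>k\<in>?J. suminf c * a k) + (\<Sum>j\<in>?J. suminf c * a j)"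
    by (intro add_mono sum_mono row) simp_all
  also have "\<dots> = (1 + 2 * suminf c) * (\<Sum>k\<in>?J. a k)"
    by (simp add: sum_distrib_left[symmetric] algebra_simps)
  finally show ?thesis .
qed

lemma square_sum_le:
  fixes f :: "'b \<Rightarrow> real"
  shows "(sum f I)\<^sup>2 \<le> real (card I) * (\<Sum>i\<in>I. (f i)\<^sup>2)"
  using Cauchy_Schwarz_ineq_sum[of "\<lambda>_. 1" f I] by simp

definition dyadic_energy :: "(nat \<Rightarrow> real) \<Rightarrow> nat \<Rightarrow> real" where
  "dyadic_energy y s = (\<Sum>i<s. \<Sum>a<2 ^ (s - i). (y (Suc a * 2 ^ i) - y (a * 2 ^ i))\<^sup>2)"

text \<open>Rademacher-Menshov chaining: clearing the binary digits of \<open>t\<close> from the lowest upwards writes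
  the interval from \<open>0\<close> to \<open>t\<close> as a union of at most one dyadic interval per level, and
  Cauchy-Schwarz over the \<open>s\<close> levels bounds the square of the sum of increments.\<close>
lemma dyadic_chaining:
  assumes "y 0 = 0" "t < 2 ^ s"
  shows "(y t)\<^sup>2 \<le> real s * dyadic_energy y s"
proof -
  \<comment> \<open>\<open>u i\<close> is \<open>t\<close> with its lowest \<open>i\<close> binary digits cleared.\<close>
  define u where "u i = t div 2 ^ i * 2 ^ i" for i
  have step: "(y (u i) - y (u (Suc i)))\<^sup>2 \<le> (\<Sum>a<2 ^ (s - i). (y (Suc a * 2 ^ i) - y (a * 2 ^ i))\<^sup>2)"
    if i: "i < s" for i
  proof -
    define h where "h = t div 2 ^ i"
    have half: "t div 2 ^ Suc i = h div 2"
      by (simp add: h_def div_mult2_eq[symmetric] mult.commute)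
    show ?thesis
    proof (cases "even h")
      case True
      then have "u (Suc i) = u i"
        unfolding u_def half by (simp add: h_def[symmetric] mult.assoc[symmetric])
      then show ?thesis by (simp add: sum_nonneg)
    next
      case False
      then obtain g where g: "h = Suc (2 * g)" by (auto elim: oddE)
      have "u (Suc i) = 2 * g * 2 ^ i" "u i = Suc (2 * g) * 2 ^ i"
        unfolding u_def half by (simp_all add: h_def[symmetric] g)
      moreover have "2 * g < 2 ^ (s - i)"
      proof -
        have "2 ^ s = (2 ^ (s - i) * 2 ^ i :: nat)" using i by (simp flip: power_add)
        then have "h < 2 ^ (s - i)"
          unfolding h_def using assms(2) by (simp add: less_mult_imp_div_less)
        then show ?thesis using g by simp
      qed
      ultimately show ?thesis
        using member_le_sum[of "2 * g" "{..<2 ^ (s - i)}" "\<lambda>a. (y (Suc a * 2 ^ i) - y (a * 2 ^ i))\<^sup>2"]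
        by simp
    qed
  qed
  have "y (u 0) - y (u s) = (\<Sum>i<s. y (u i) - y (u (Suc i)))"
    by (rule sum_lessThan_telescope'[symmetric])
  moreover have "u 0 = t" "u s = 0" using assms(2) by (simp_all add: u_def)
  ultimately have "(y t)\<^sup>2 = (\<Sum>i<s. y (u i) - y (u (Suc i)))\<^sup>2"
    using assms(1) by simp
  also have "\<dots> \<le> real s * (\<Sum>i<s. (y (u i) - y (u (Suc i)))\<^sup>2)"
    using square_sum_le[of "\<lambda>i. y (u i) - y (u (Suc i))" "{..<s}"] by simp
  also have "\<dots> \<le> real s * dyadic_energy y s"
    unfolding dyadic_energy_def by (intro mult_left_mono sum_mono step) auto
  finally show ?thesis .
qed

lemma AE_bounded_of_summable_expectations:
  fixes V :: "nat \<Rightarrow> 'a \<Rightarrow> real"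
  assumes int: "\<And>s. integrable M (V s)" and nonneg: "\<And>s x. 0 \<le> V s x"
    and le: "\<And>s. integral\<^sup>L M (V s) \<le> v s" and v: "summable v"
  shows "AE x in M. \<exists>B\<ge>0. \<forall>s. V s x \<le> B"
proof -
  have [measurable]: "V s \<in> borel_measurable M" for s using int by auto
  have v0: "0 \<le> v s" for s
    using le[of s] Bochner_Integration.integral_nonneg[of M "V s"] nonneg by (metis order_trans)
  have "(\<integral>\<^sup>+x. (\<Sum>s. ennreal (V s x)) \<partial>M) = (\<Sum>s. \<integral>\<^sup>+x. ennreal (V s x) \<partial>M)"
    by (intro nn_integral_suminf) measurable
  also have "\<dots> \<le> (\<Sum>s. ennreal (v s))"
    by (intro suminf_le) (auto simp: nn_integral_eq_integral[OF int] nonneg le ennreal_leI)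
  also have "\<dots> = ennreal (suminf v)"
    using suminf_ennreal2[OF v0 v] .
  finally have "(\<integral>\<^sup>+x. (\<Sum>s. ennreal (V s x)) \<partial>M) \<noteq> \<infinity>"
    by (metis ennreal_neq_top infinity_ennreal_def neq_top_trans)
  then have "AE x in M. (\<Sum>s. ennreal (V s x)) \<noteq> \<infinity>"
    by (intro nn_integral_PInf_AE) auto
  then show ?thesis
  proof eventually_elim
    case (elim x)
    define B where "B = enn2real (\<Sum>s. ennreal (V s x))"
    have B: "ennreal B = (\<Sum>s. ennreal (V s x))"
      unfolding B_def using elim by (simp add: ennreal_enn2real_if)
    have "0 \<le> B" by (simp add: B_def)
    moreover have "V s x \<le> B" for s
    proof -
      have "ennreal (V s x) \<le> (\<Sum>s. ennreal (V s x))"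
        using sum_le_suminf[of "\<lambda>s. ennreal (V s x)" "{s}"] by auto
      then show ?thesis unfolding B[symmetric] ennreal_le_iff[OF \<open>0 \<le> B\<close>] .
    qed
    ultimately show ?case by blast
  qed
qed

text \<open>The method of Gal and Koksma. Sampling at the times \<open>N t\<close> at which \<open>\<Phi>\<close> reaches \<open>t\<close> turns the
  variance hypothesis into a bound linear in \<open>t\<close>, which is why the error is a power of \<open>ln (\<Phi> n)\<close> and
  not of \<open>ln n\<close>. The dyadic energy up to level \<open>2 ^ s\<close> has expectation \<open>O(s 2\<^sup>s)\<close>; dividing by
  \<open>2\<^sup>s s\<^bsup>2 + 2\<epsilon>\<^esup>\<close> makes the expectations summable, so almost surely the energy is \<open>O(2\<^sup>s s\<^bsup>2 + 2\<epsilon>\<^esup>)\<close>, and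
  chaining costs one more factor \<open>s\<close>. Its square root is the claimed error. Between sample times
  the count and \<open>\<Phi>\<close> are both monotone, and \<open>\<Phi>\<close> grows by a bounded amount.\<close>
lemma (in prob_space) gal_koksma:
  fixes f :: "nat \<Rightarrow> 'a \<Rightarrow> real" and a :: "nat \<Rightarrow> real" and K \<epsilon> :: real
  defines "\<Phi> \<equiv> \<lambda>n. \<Sum>k=1..n. a k"
  assumes meas [measurable]: "\<And>k. f k \<in> borel_measurable M"
    and f01: "\<And>k x. 0 \<le> f k x" "\<And>k x. f k x \<le> 1"
    and a01: "\<And>k. 1 \<le> k \<Longrightarrow> 0 \<le> a k" "\<And>k. 1 \<le> k \<Longrightarrow> a k \<le> 1"
    and K: "0 \<le> K"
    and var: "\<And>m n. expectation (\<lambda>x. (\<Sum>k\<in>{m<..n}. f k x - a k)\<^sup>2) \<le> K * (\<Sum>k\<in>{m<..n}. a k)"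
    and unbounded: "\<not> bounded (range \<Phi>)" and \<epsilon>: "0 < \<epsilon>"
  shows "AE x in M. (\<lambda>n. (\<Sum>k=1..n. f k x) - \<Phi> n)
    \<in> O(\<lambda>n. \<Phi> n powr (1/2) * ln (\<Phi> n) powr (3/2 + \<epsilon>))"
proof -
  have \<Phi>0: "\<Phi> 0 = 0" and \<Phi>_Suc: "\<Phi> (Suc n) = \<Phi> n + a (Suc n)" for n
    by (simp_all add: \<Phi>_def)
  have mono: "mono \<Phi>"
    using a01 by (intro monoI) (auto simp: \<Phi>_def intro!: sum_mono2)
  then have \<Phi>_nonneg: "0 \<le> \<Phi> n" for n
    using \<Phi>0 by (metis le0 monoD)
  have large: "\<exists>n. c \<le> \<Phi> n" for c
  proof (rule ccontr)
    assume "\<nexists>n. c \<le> \<Phi> n"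
    then have "norm (\<Phi> n) \<le> c" for n
      using \<Phi>_nonneg[of n] by (simp add: not_le less_imp_le)
    then show False using unbounded by (auto simp: bounded_iff)
  qed

  define N where "N t = (LEAST n. real t \<le> \<Phi> n)" for t :: nat
  have N_ge: "real t \<le> \<Phi> (N t)" for t
    unfolding N_def by (rule LeastI_ex) (rule large)
  have N_less: "\<Phi> n < real t" if "n < N t" for n t
    using not_less_Least[of n "\<lambda>n. real t \<le> \<Phi> n"] that by (simp add: N_def)
  have N_lt: "\<Phi> (N t) < real t + 1" for t
  proof (cases "N t")
    case (Suc n)
    then have "\<Phi> n < real t" by (intro N_less) simp
    then show ?thesis using a01(2)[of "Suc n"] by (simp add: Suc \<Phi>_Suc)
  qed (simp add: \<Phi>0)
  have N0: "N 0 = 0"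
    unfolding N_def by (rule Least_eq_0) (simp add: \<Phi>0)
  have N_mono: "N t \<le> N u" if "t \<le> u" for t u
    unfolding N_def[of t] using N_ge[of u] that by (intro Least_le) simp

  define Y where "Y x t = (\<Sum>k=1..N t. f k x - a k)" for x t
  have Y0: "Y x 0 = 0" for x by (simp add: Y_def N0)
  have Y_diff: "Y x v - Y x u = (\<Sum>k\<in>{N u<..N v}. f k x - a k)" if "u \<le> v" for x u v
  proof -
    have "{1..N v} = {1..N u} \<union> {N u<..N v}" using N_mono[OF that] by auto
    then have "Y x v = Y x u + (\<Sum>k\<in>{N u<..N v}. f k x - a k)"
      unfolding Y_def by (subst sum.union_disjoint[symmetric]) auto
    then show ?thesis by simp
  qed
  have int: "integrable M (\<lambda>x. (\<Sum>k\<in>{m<..n}. f k x - a k)\<^sup>2)" for m n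
  proof (rule integrable_const_bound)
    have "\<bar>\<Sum>k\<in>{m<..n}. f k x - a k\<bar> \<le> real (n - m)" for x
    proof -
      have "\<bar>\<Sum>k\<in>{m<..n}. f k x - a k\<bar> \<le> (\<Sum>k\<in>{m<..n}. \<bar>f k x - a k\<bar>)"
        by (rule sum_abs)
      also have "\<dots> \<le> (\<Sum>k\<in>{m<..n}. 1)"
      proof (rule sum_mono)
        fix k assume "k \<in> {m<..n}"
        then show "\<bar>f k x - a k\<bar> \<le> 1"
          using f01(1)[of k x] f01(2)[of k x] a01[of k] by simp
      qed
      finally show ?thesis by simp
    qed
    then show "AE x in M. norm ((\<Sum>k\<in>{m<..n}. f k x - a k)\<^sup>2) \<le> (real (n - m))\<^sup>2"
      by (intro AE_I2) (simp add: abs_le_square_iff[symmetric])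
    show "(\<lambda>x. (\<Sum>k\<in>{m<..n}. f k x - a k)\<^sup>2) \<in> borel_measurable M"
      by measurable
  qed
  have Y_int: "integrable M (\<lambda>x. (Y x v - Y x u)\<^sup>2)" if "u \<le> v" for u v
    unfolding Y_diff[OF that] by (rule int)
  have Y_var: "expectation (\<lambda>x. (Y x v - Y x u)\<^sup>2) \<le> K * (real v - real u + 1)"
    if "u \<le> v" for u v
  proof -
    have "{1..N v} = {1..N u} \<union> {N u<..N v}" using N_mono[OF that] by auto
    then have "\<Phi> (N v) = \<Phi> (N u) + (\<Sum>k\<in>{N u<..N v}. a k)"
      unfolding \<Phi>_def by (subst sum.union_disjoint[symmetric]) auto
    then have "(\<Sum>k\<in>{N u<..N v}. a k) \<le> real v - real u + 1"
      using N_ge[of u] N_lt[of v] by linarith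
    then show ?thesis
      unfolding Y_diff[OF that] using var[of "N u" "N v"] K by (meson mult_left_mono order_trans)
  qed

  define W where "W s x = dyadic_energy (Y x) s" for s x
  have le_step: "a * 2 ^ i \<le> Suc a * 2 ^ i" for a i :: nat by simp
  have W_nonneg: "0 \<le> W s x" for s x
    by (simp add: W_def dyadic_energy_def sum_nonneg)
  have W_int: "integrable M (W s)" for s
    unfolding W_def dyadic_energy_def
    by (intro Bochner_Integration.integrable_sum Y_int le_step)
  have W_exp: "expectation (W s) \<le> 2 * K * real s * 2 ^ s" for s
  proof -
    have "expectation (W s) = (\<Sum>i<s. \<Sum>a<2 ^ (s - i).
        expectation (\<lambda>x. (Y x (Suc a * 2 ^ i) - Y x (a * 2 ^ i))\<^sup>2))"
      unfolding W_def dyadic_energy_def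
      by (simp only: Bochner_Integration.integral_sum Bochner_Integration.integrable_sum
          Y_int[OF le_step])
    also have "\<dots> \<le> (\<Sum>i<s. \<Sum>a<(2::nat) ^ (s - i). K * (2 * 2 ^ i))"
    proof (intro sum_mono)
      fix i a
      have "expectation (\<lambda>x. (Y x (Suc a * 2 ^ i) - Y x (a * 2 ^ i))\<^sup>2) \<le> K * (2 ^ i + 1)"
        using Y_var[OF le_step[of a i]] by (simp add: algebra_simps)
      also have "\<dots> \<le> K * (2 * 2 ^ i)"
        using K by (intro mult_left_mono) simp_all
      finally show "expectation (\<lambda>x. (Y x (Suc a * 2 ^ i) - Y x (a * 2 ^ i))\<^sup>2) \<le> K * (2 * 2 ^ i)" .
    qed
    also have "\<dots> = (\<Sum>i<s. 2 * K * 2 ^ s)"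
    proof (intro sum.cong refl)
      fix i assume "i \<in> {..<s}"
      then have "(2::real) ^ s = 2 ^ (s - i) * 2 ^ i" by (simp flip: power_add)
      then show "(\<Sum>a<(2::nat) ^ (s - i). K * (2 * 2 ^ i)) = 2 * K * 2 ^ s" by simp
    qed
    finally show ?thesis by (simp add: mult_ac)
  qed

  \<comment> \<open>At \<open>s = 0\<close> the divisor is \<open>0\<close>, so \<open>V 0\<close> vanishes.\<close>
  define V where "V s x = W s x / (2 ^ s * real s powr (2 + 2 * \<epsilon>))" for s x
  have "AE x in M. \<exists>B\<ge>0. \<forall>s. V s x \<le> B"
  proof (rule AE_bounded_of_summable_expectations)
    show "integrable M (V s)" for s unfolding V_def using W_int by simp
    show "0 \<le> V s x" for s x using W_nonneg by (simp add: V_def)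
    show "summable (\<lambda>s. 2 * K * real s powr (- 1 - 2 * \<epsilon>))"
      using \<epsilon> by (intro summable_mult) (simp add: summable_real_powr_iff)
    fix s
    show "integral\<^sup>L M (V s) \<le> 2 * K * real s powr (- 1 - 2 * \<epsilon>)"
    proof (cases "s = 0")
      case False
      have "expectation (V s) = expectation (W s) / (2 ^ s * real s powr (2 + 2 * \<epsilon>))"
        unfolding V_def by simp
      also have "\<dots> \<le> 2 * K * real s * 2 ^ s / (2 ^ s * real s powr (2 + 2 * \<epsilon>))"
        using W_exp by (intro divide_right_mono) auto
      also have "\<dots> = 2 * K * (real s powr 1 / real s powr (2 + 2 * \<epsilon>))"
        by simp
      also have "\<dots> = 2 * K * real s powr (- 1 - 2 * \<epsilon>)"
        by (simp only: powr_diff[symmetric]) simp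
      finally show ?thesis .
    qed (simp add: V_def [abs_def])
  qed
  then show ?thesis
  proof eventually_elim
    case (elim x)
    then obtain B where B: "B \<ge> 0" "\<And>s. V s x \<le> B" by blast
    define p where "p = 3 / 2 + \<epsilon>"
    define C where "C = sqrt B * 2 * 4 powr p + 2"
    have chain: "(Y x u)\<^sup>2 \<le> B * 2 ^ s * real s powr (2 * p)" if "u < 2 ^ s" "1 \<le> s" for u s
    proof -
      have "(Y x u)\<^sup>2 \<le> real s * W s x"
        unfolding W_def by (rule dyadic_chaining[of "Y x", OF Y0 that(1)])
      also have "\<dots> \<le> real s * (B * (2 ^ s * real s powr (2 + 2 * \<epsilon>)))"
        using B(2)[of s] that by (intro mult_left_mono) (simp_all add: V_def divide_le_eq)
      also have "\<dots> = B * 2 ^ s * (real s powr 1 * real s powr (2 + 2 * \<epsilon>))"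
        using that by simp
      also have "\<dots> = B * 2 ^ s * real s powr (2 * p)"
        by (simp only: powr_add[symmetric] p_def) (simp add: algebra_simps)
      finally show ?thesis .
    qed
    have bound: "\<bar>(\<Sum>k=1..n. f k x) - \<Phi> n\<bar> \<le> C * (\<Phi> n powr (1/2) * ln (\<Phi> n) powr p)"
      if n: "4 \<le> \<Phi> n" for n
    proof -
      define t where "t = nat \<lfloor>\<Phi> n\<rfloor>"
      have t: "real t \<le> \<Phi> n" "\<Phi> n < real t + 1"
        using n by (simp_all add: t_def)
      then have "4 \<le> t" using n by linarith
      \<comment> \<open>The sandwich below uses the samples at both \<open>t\<close> and \<open>t + 1\<close>, so \<open>2 ^ s\<close> must exceed \<open>t + 1\<close>.\<close>
      obtain s0 where s0: "2 ^ s0 \<le> t + 1" "t + 1 < 2 ^ (s0 + 1)"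
        using ex_power_ivl1[of 2 "t + 1"] by auto
      define s where "s = s0 + 1"
      have "1 \<le> s" "t + 1 < 2 ^ s" using s0 by (simp_all add: s_def)
      have pow: "2 ^ s \<le> 4 * \<Phi> n"
      proof -
        have "(2::real) ^ s0 \<le> real t + 1" 
          using of_nat_mono[OF s0(1), where ?'a = real] by simp
        then show ?thesis using t n by (simp add: s_def)
      qed
      have lnn: "1 \<le> ln (\<Phi> n)"
      proof -
        have "2 * ln 2 = ln (4::real)" using ln_realpow[of 2 2] by simp
        moreover have "ln 4 \<le> ln (\<Phi> n)" using n by simp
        ultimately show ?thesis using ln2_ge_two_thirds by linarith
      qed
      have "real s \<le> 4 * ln (\<Phi> n)"
      proof -
        have "real s * ln 2 = ln (2 ^ s)" by (simp add: ln_realpow)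
        also have "\<dots> \<le> ln (4 * \<Phi> n)" using pow n by simp
        also have "\<dots> \<le> ln (\<Phi> n * \<Phi> n)" using n by (subst ln_le_cancel_iff) auto
        also have "\<dots> = 2 * ln (\<Phi> n)" using n by (simp add: ln_mult)
        finally have "real s * ln 2 \<le> 2 * ln (\<Phi> n)" .
        moreover have "real s * (1 / 2) \<le> real s * ln 2"
          using ln2_ge_two_thirds by (intro mult_left_mono) auto
        ultimately show ?thesis by linarith
      qed
      then have spow: "real s powr (2 * p) \<le> (4 * ln (\<Phi> n)) powr (2 * p)"
        using \<epsilon> by (intro powr_mono2) (auto simp: p_def)
      define G where "G = \<Phi> n powr (1/2) * ln (\<Phi> n) powr p"
      have G1: "1 \<le> G"
      proof -
        have "1 \<le> \<Phi> n powr (1/2)" "1 \<le> ln (\<Phi> n) powr p"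
          using n lnn \<epsilon> by (auto intro!: ge_one_powr_ge_zero simp: p_def)
        from mult_mono[OF this] show ?thesis by (simp add: G_def)
      qed
      have Y_le: "\<bar>Y x u\<bar> \<le> sqrt B * 2 * 4 powr p * G" if "u \<le> t + 1" for u
      proof -
        have "(Y x u)\<^sup>2 \<le> B * 2 ^ s * real s powr (2 * p)"
          using that \<open>1 \<le> s\<close> \<open>t + 1 < 2 ^ s\<close> by (intro chain) auto
        also have "\<dots> \<le> B * (4 * \<Phi> n) * (4 * ln (\<Phi> n)) powr (2 * p)"
          using B(1) pow spow n by (intro mult_mono) auto
        also have "\<dots> = (sqrt B * 2 * 4 powr p * G)\<^sup>2"
        proof -
          have "(c powr p)\<^sup>2 = c powr (2 * p)" for c :: real
            by (simp add: power2_eq_square powr_add[symmetric])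
          moreover have "(\<Phi> n powr (1/2))\<^sup>2 = \<Phi> n"
            using n by (simp add: powr_half_sqrt)
          ultimately show ?thesis
            using B(1) n lnn by (simp add: G_def power_mult_distrib powr_mult)
        qed
        finally have "\<bar>Y x u\<bar> \<le> \<bar>sqrt B * 2 * 4 powr p * G\<bar>"
          by (simp only: abs_le_square_iff)
        moreover have "0 \<le> sqrt B * 2 * 4 powr p * G" using B(1) G1 by simp
        ultimately show ?thesis by simp
      qed
      have "N t \<le> n" unfolding N_def using t by (intro Least_le) simp
      moreover have "n \<le> N (t + 1)"
      proof (rule ccontr)
        assume "\<not> n \<le> N (t + 1)"
        then have "\<Phi> (N (t + 1)) \<le> \<Phi> n" using monoD[OF mono] by simp
        then show False using N_ge[of "t + 1"] t by simp
      qed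
      ultimately have "(\<Sum>k=1..N t. f k x) \<le> (\<Sum>k=1..n. f k x)"
        "(\<Sum>k=1..n. f k x) \<le> (\<Sum>k=1..N (t + 1). f k x)"
        using f01(1) by (auto intro!: sum_mono2)
      moreover have "(\<Sum>k=1..N u. f k x) = Y x u + \<Phi> (N u)" for u
        by (simp add: Y_def \<Phi>_def sum_subtractf)
      ultimately have "\<bar>(\<Sum>k=1..n. f k x) - \<Phi> n\<bar> \<le> max \<bar>Y x t\<bar> \<bar>Y x (t + 1)\<bar> + 2"
        using t N_ge[of t] N_lt[of "t + 1"] by auto
      also have "\<dots> \<le> sqrt B * 2 * 4 powr p * G + 2 * G"
        using Y_le[of t] Y_le[of "t + 1"] G1 by simp
      also have "\<dots> = C * G" by (simp add: C_def algebra_simps)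
      finally show ?thesis by (simp add: G_def)
    qed
    obtain n0 where "4 \<le> \<Phi> n0" using large by blast
    then have "4 \<le> \<Phi> n" if "n \<ge> n0" for n
      using monoD[OF mono that] by simp
    then have "eventually (\<lambda>n. 4 \<le> \<Phi> n) sequentially"
      by (auto simp: eventually_sequentially)
    then have "eventually (\<lambda>n. norm ((\<Sum>k=1..n. f k x) - \<Phi> n)
        \<le> C * norm (\<Phi> n powr (1/2) * ln (\<Phi> n) powr (3/2 + \<epsilon>))) sequentially"
      by eventually_elim (use bound in \<open>simp add: p_def abs_mult\<close>)
    then show ?case by (rule bigoI)
  qed
qed

section \<open>Counting returns\<close>

theorem proposition2:
  fixes A :: "int^2^2"
    and M r :: "nat \<Rightarrow> real"
    and C :: real
    and \<Phi> :: "nat \<Rightarrow> real"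
    and S :: "nat \<Rightarrow> torus2 \<Rightarrow> real"
  assumes det_A: "\<bar>det A\<bar> = 1"
    and hyperbolic: "\<And>c. matrix_eigenvalue (map_matrix of_int A :: complex^2^2) c \<Longrightarrow> cmod c \<noteq> 1"
    and M_range: "\<And>k. k \<ge> 1 \<Longrightarrow> M k \<in> {0..1}"
    and M_decreasing: "antimono_on {1..} M"
    and C_pos: "C > 0"
    and M_bound: "\<And>k. k \<ge> 2 \<Longrightarrow> M k \<le> C * (ln (real k)) powr (-2)"
    and r_nonneg: "\<And>k. k \<ge> 1 \<Longrightarrow> r k \<ge> 0"
    and ball_measure: "\<And>k x. k \<ge> 1 \<Longrightarrow> measure torus_lborel (ball x (r k)) = M k"
    and ball_area: "\<And>k. k \<ge> 1 \<Longrightarrow> M k = pi * (r k)\<^sup>2"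
    and \<Phi>_eq: "\<And>n. \<Phi> n = (\<Sum>k=1..n. M k)"
    and S_eq: "\<And>n x. S n x = (\<Sum>k=1..n. indicator (ball x (r k)) ((torus_map A ^^ k) x))"
  shows "(\<not> bounded (range \<Phi>) \<longrightarrow>
            (\<forall>\<epsilon>>0. AE x in torus_lborel.
              (\<lambda>n. S n x - \<Phi> n) \<in> O(\<lambda>n. \<Phi> n powr (1/2) * ln (\<Phi> n) powr (3/2 + \<epsilon>)))) \<and>
         (bounded (range \<Phi>) \<longrightarrow>
            (AE x in torus_lborel. bounded (range (\<lambda>n. S n x - \<Phi> n))))"
proof -
  interpret T: prob_space torus_lborel by (rule prob_space_torus_lborel)
  define E where "E k = return_set A k (r k)" for k
  have E_meas [measurable]: "E k \<in> T.events" for k by (simp add: E_def)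
  have S_E: "S n x = (\<Sum>k=1..n. indicator (E k) x)" for n x
    by (simp add: S_eq E_def return_set_def indicator_def)
  have \<Phi>_fun: "\<Phi> = (\<lambda>n. \<Sum>k=1..n. M k)" using \<Phi>_eq by auto
  obtain D \<theta> where D: "D > 0" and \<theta>: "0 < \<theta>" "\<theta> < 1"
    and single: "\<And>k r y. 1 \<le> k \<Longrightarrow>
      measure torus_lborel (return_set A k r) = measure torus_lborel (ball y r)"
    and pair: "\<And>j k r s. 1 \<le> j \<Longrightarrow> j < k \<Longrightarrow> 0 \<le> r \<Longrightarrow>
      measure torus_lborel (return_set A j r \<inter> return_set A k s)
        \<le> pi * (r + D * \<theta> ^ (k - j))\<^sup>2 * measure torus_lborel (return_set A k s)"
    using return_sets_quasi_independent[OF det_A hyperbolic] by blast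
  have prob_E: "T.prob (E k) = M k" if "1 \<le> k" for k
    using single[OF that, of "r k" undefined] ball_measure[OF that] by (simp add: E_def)
  define c where "c d = pi * (2 + D) * D * \<theta> ^ d" for d
  have c_nonneg: "0 \<le> c d" for d using D \<theta> by (simp add: c_def)
  have c_summable: "summable c"
    unfolding c_def using \<theta> by (intro summable_mult summable_geometric) simp
  \<comment> \<open>Enlarging a disc of radius at most \<open>1\<close> by \<open>e \<le> D\<close> adds an area of at most \<open>pi * (2 + D) * e\<close>.\<close>
  have pair_E: "T.prob (E j \<inter> E k) \<le> M j * M k + c (k - j) * M k" if jk: "1 \<le> j" "j < k" for j k
  proof -
    define e where "e = D * \<theta> ^ (k - j)"
    have "\<theta> ^ (k - j) \<le> 1" using \<theta> by (intro power_le_one) auto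
    then have e: "0 \<le> e" "e \<le> D" using D \<theta> by (simp_all add: e_def mult_left_le)
    have Mj: "M j = pi * (r j)\<^sup>2" "M j \<le> 1" using ball_area M_range jk by auto
    have "1 * (r j)\<^sup>2 \<le> pi * (r j)\<^sup>2" using pi_ge_two by (intro mult_right_mono) auto
    then have "(r j)\<^sup>2 \<le> 1\<^sup>2" using Mj by simp
    then have "r j \<le> 1" by (rule power2_le_imp_le) simp
    have "pi * (r j + e)\<^sup>2 = M j + pi * ((2 * r j + e) * e)"
      by (simp add: Mj(1) power2_eq_square algebra_simps)
    also have "\<dots> \<le> M j + pi * ((2 + D) * e)"
      using \<open>r j \<le> 1\<close> e by (intro add_left_mono mult_left_mono mult_right_mono) auto
    also have "\<dots> = M j + c (k - j)" by (simp add: c_def e_def)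
    finally have "pi * (r j + e)\<^sup>2 \<le> M j + c (k - j)" .
    moreover have "T.prob (E j \<inter> E k) \<le> pi * (r j + e)\<^sup>2 * M k"
      using pair[OF jk, of "r j" "r k"] r_nonneg[of j] prob_E[of k] jk by (simp add: E_def e_def)
    moreover have "0 \<le> M k" using M_range[of k] jk by simp
    ultimately have "T.prob (E j \<inter> E k) \<le> (M j + c (k - j)) * M k"
      by (meson mult_right_mono order_trans)
    then show ?thesis by (simp add: distrib_right)
  qed
  show ?thesis
  proof (intro conjI impI allI)
    fix \<epsilon> :: real assume "\<epsilon> > 0" and unb: "\<not> bounded (range \<Phi>)"
    show "AE x in torus_lborel.
        (\<lambda>n. S n x - \<Phi> n) \<in> O(\<lambda>n. \<Phi> n powr (1/2) * ln (\<Phi> n) powr (3/2 + \<epsilon>))"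
      unfolding S_E \<Phi>_fun
    proof (rule T.gal_koksma[where K = "1 + 2 * suminf c"])
      show "0 \<le> 1 + 2 * suminf c" using suminf_nonneg[OF c_summable c_nonneg] by simp
      show "T.expectation (\<lambda>x. (\<Sum>k\<in>{m<..n}. indicator (E k) x - M k)\<^sup>2)
          \<le> (1 + 2 * suminf c) * (\<Sum>k\<in>{m<..n}. M k)" for m n
        by (rule T.quasi_independent_variance[OF E_meas prob_E pair_E c_nonneg c_summable])
      show "\<not> bounded (range (\<lambda>n. \<Sum>k=1..n. M k))" using unb by (simp add: \<Phi>_fun)
    qed (use M_range \<open>\<epsilon> > 0\<close> in \<open>auto simp: indicator_def\<close>)
  next
    assume bdd: "bounded (range \<Phi>)"
    obtain B where B: "\<And>n. \<bar>\<Phi> n\<bar> \<le> B" using bdd by (auto simp: bounded_iff)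
    have "summable (\<lambda>k. T.prob (E (Suc k)))"
    proof (rule bounded_imp_summable)
      fix n
      have "(\<Sum>k\<le>n. T.prob (E (Suc k))) = \<Phi> (Suc n)"
        unfolding \<Phi>_eq atMost_atLeast0 One_nat_def sum.shift_bounds_cl_Suc_ivl
        by (simp add: prob_E)
      then show "(\<Sum>k\<le>n. T.prob (E (Suc k))) \<le> B" using B[of "Suc n"] by simp
    qed simp
    then have "AE x in torus_lborel. eventually (\<lambda>k. x \<in> space torus_lborel - E (Suc k)) sequentially"
      by (intro borel_cantelli_AE1) (use E_meas in \<open>auto simp: T.emeasure_eq_measure\<close>)
    then show "AE x in torus_lborel. bounded (range (\<lambda>n. S n x - \<Phi> n))"
    proof eventually_elim
      case (elim x)
      then obtain m where m: "\<And>k. m \<le> k \<Longrightarrow> x \<notin> E (Suc k)"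
        by (auto simp: eventually_sequentially)
      have "norm (S n x) \<le> real m" for n
      proof -
        have "S n x = (\<Sum>k\<in>{1..n} \<inter> {k. x \<in> E k}. 1)"
          by (simp add: S_E sum.inter_restrict indicator_def)
        also have "\<dots> \<le> (\<Sum>k\<in>{1..m}. 1)"
        proof (rule sum_mono2)
          have "k \<le> m" if "1 \<le> k" "x \<in> E k" for k
            using m[of "k - 1"] that by (cases k) force+
          then show "{1..n} \<inter> {k. x \<in> E k} \<subseteq> {1..m}" by auto
        qed auto
        finally show ?thesis by (simp add: S_E sum_nonneg)
      qed
      then have "bounded (range (\<lambda>n. S n x))" by (auto simp: bounded_iff)
      then show ?case using bdd by (rule bounded_minus_comp)
    qed
  qed
qed

end
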